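(* Let $[A,(B_{::})]$ be an array of $q\ge 2$ linear time-invariant systems with relative actuation, let $\mathbf{W}$ be its controllability matrix, and let $\mu_1,\dots,\mu_m$ be the distinct eigenvalues of $A^{*}$ with associated eigenvector matrices $V_1,\dots,V_m$ (all as defined in the context). The following are equivalent. 1. The array $[A,(B_{::})]$ is controllable. 2. The controllability matrix $\mathbf{W}$ is connected. 3. All the matrices $\mathrm{inc}(V_1^{*}B_{::}),\ \mathrm{inc}(V_2^{*}B_{::}),\dots,\mathrm{inc}(V_m^{*}B_{::})$ are connected.
   Context: Array. Let $q\ge 2$, $n,p\ge 1$ be integers, $A\in\mathbb{R}^{n\times n}$, and $B_{i\sigma}\in\mathbb{R}^{n\times 1}$ ($i=1,\dots,q$; $\sigma=1,\dots,p$) satisfying $\sum_{i=1}^{q}B_{i\sigma}=0$ for every $\sigma$ (relative actuation). The array $[A,(B_{::})]$ is the collection of systems $\dot x_i=Ax_i+\sum_{\sigma=1}^{p}B_{i\sigma}u_\sigma$, $i=1,\dots,q$, with states $x_i\in\mathbb{R}^n$ and scalar inputs $u_\sigma\in\mathbb{R}$. Input signals are (Lebesgue) integrable functions on bounded intervals. Controllability. The array is controllable if for each set of initial conditions $(x_1(0),\dots,x_q(0))$ there exist a finite time $\tau>0$ and input signals $u_\sigma:[0,\tau]\to\mathbb{R}$ such that $x_i(\tau)=x_j(\tau)$ for all $(i,j)$. Incidence matrix. $M^{*}$ denotes the conjugate transpose of $M$. For a collection of matrices $(C_{i\sigma})_{i=1,\dots,q;\,\sigma=1,\dots,p}$ of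 equal size, $\mathrm{inc}(C_{::})$ is the block matrix whose $(i,\sigma)$ block is $C_{i\sigma}$. For a matrix $M$, $(MB_{::})$ denotes the collection with members $MB_{i\sigma}$. Let $\mathbf{A}=I_q\otimes A$, $\mathbf{B}=\mathrm{inc}(B_{::})\in\mathbb{R}^{qn\times p}$, and $\mathbf{W}=[\mathbf{B}\ \mathbf{A}\mathbf{B}\ \cdots\ \mathbf{A}^{n-1}\mathbf{B}]$ (the controllability matrix). Eigenvectors. $\mu_1,\dots,\mu_m$ are the distinct eigenvalues of $A^{*}$. For each $\kappa$, $V_\kappa\in\mathbb{C}^{n\times d_\kappa}$ is a full column rank matrix with $\mathrm{range}\,V_\kappa=\mathrm{null}(A^{*}-\mu_\kappa I_n)$, taken real when $\mu_\kappa\in\mathbb{R}$. Connectedness. For a positive integer $d$, $\mathcal{S}_d=\mathrm{range}(\mathbf{1}_q\otimes I_d)$, where $\mathbf{1}_q$ is the $q$-vector of all ones, and $\mathcal{S}_d^{\perp}$ is its orthogonal complement. A matrix $G$ with $qd$ rows belongs to class-$\mathcal{G}_d$ if $\mathrm{range}\,G\subset\mathcal{S}_d^{\perp}$; such a $G$ is connected if $\mathrm{range}\,G\supset\mathcal{S}_d^{\perp}$. For complex matrices, ranges and the subspaces $\mathcal{S}_d,\mathcal{S}_d^\perp$ are understood over $\mathbb{C}$. Here $\mathbf{W}\in\mathcal{G}_n$ and $\mathrm{inc}(V_\kappa^{*}B_{::})\in\mathcal{G}_{d_\kappa}$. *)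

theory Defs
  imports
    "HOL-Analysis.Analysis"
    "Jordan_Normal_Form.Matrix"
    "Jordan_Normal_Form.Matrix_Kernel"
    "Jordan_Normal_Form.DL_Rank"
    "Jordan_Normal_Form.Schur_Decomposition"
    "Jordan_Normal_Form.Spectral_Radius"
begin

text \<open>Free the infix \<open>$\<close> of the finite Cartesian products, which clashes with the
  component access of \<^typ>\<open>'a Matrix.vec\<close>.\<close>

unbundle no vec_syntax

abbreviation cmat :: "real mat \<Rightarrow> complex mat" where
  "cmat \<equiv> map_mat complex_of_real"

definition kronecker :: "'a::semiring_1 mat \<Rightarrow> 'a mat \<Rightarrow> 'a mat" where
  "kronecker M N = mat (dim_row M * dim_row N) (dim_col M * dim_col N)
     (\<lambda>(i, j). M $$ (i div dim_row N, j div dim_col N) * N $$ (i mod dim_row N, j mod dim_col N))"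

definition mat_range :: "'a::semiring_0 mat \<Rightarrow> 'a vec set" where
  "mat_range M = (\<lambda>x. M *\<^sub>v x) ` carrier_vec (dim_col M)"

text \<open>Systems and inputs are indexed from 0, i.e. by \<open>i < q\<close> and \<open>\<sigma> < p\<close>. The parameters
  \<open>r\<close> and \<open>c\<close> give the common size \<open>r \<times> c\<close> of the blocks \<open>C i \<sigma>\<close>.\<close>

definition inc :: "nat \<Rightarrow> nat \<Rightarrow> nat \<Rightarrow> nat \<Rightarrow> (nat \<Rightarrow> nat \<Rightarrow> 'a mat) \<Rightarrow> 'a mat" where
  "inc q p r c C = mat (q * r) (p * c) (\<lambda>(i, j). C (i div r) (j div c) $$ (i mod r, j mod c))"

definition relative_actuation :: "nat \<Rightarrow> nat \<Rightarrow> nat \<Rightarrow> (nat \<Rightarrow> nat \<Rightarrow> real mat) \<Rightarrow> bool" where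
  "relative_actuation q n p B \<longleftrightarrow> (\<forall>\<sigma><p. \<forall>k<n. (\<Sum>i<q. B i \<sigma> $$ (k, 0)) = 0)"

definition ctrb_matrix ::
  "nat \<Rightarrow> nat \<Rightarrow> nat \<Rightarrow> real mat \<Rightarrow> (nat \<Rightarrow> nat \<Rightarrow> real mat) \<Rightarrow> real mat" where
  "ctrb_matrix q n p A B = mat (q * n) (n * p)
     (\<lambda>(i, j). ((kronecker (1\<^sub>m q) A ^\<^sub>m (j div p)) * inc q p n 1 B) $$ (i, j mod p))"

text \<open>Since the inputs are merely integrable, \<open>x' = A x + (\<Sum>\<sigma><p. b \<sigma> u\<^sub>\<sigma>)\<close>, \<open>x(0) = x0\<close> is
  understood in the sense of Caratheodory, i.e. as the integral equation, which is written
  componentwise because \<^typ>\<open>real vec\<close> carries no topology.\<close>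

definition array_solution :: "nat \<Rightarrow> nat \<Rightarrow> real mat \<Rightarrow> (nat \<Rightarrow> real mat) \<Rightarrow> real \<Rightarrow>
    (nat \<Rightarrow> real \<Rightarrow> real) \<Rightarrow> real vec \<Rightarrow> (real \<Rightarrow> real vec) \<Rightarrow> bool" where
  "array_solution n p A b \<tau> u x0 x \<longleftrightarrow>
     (\<forall>t\<in>{0..\<tau>}. x t \<in> carrier_vec n) \<and>
     (\<forall>k<n. let f = (\<lambda>s. (A *\<^sub>v x s) $ k + (\<Sum>\<sigma><p. b \<sigma> $$ (k, 0) * u \<sigma> s)) in
        set_integrable lebesgue {0..\<tau>} f \<and>
        (\<forall>t\<in>{0..\<tau>}. x t $ k = x0 $ k + set_lebesgue_integral lebesgue {0..t} f))"

definition array_controllable ::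
  "nat \<Rightarrow> nat \<Rightarrow> nat \<Rightarrow> real mat \<Rightarrow> (nat \<Rightarrow> nat \<Rightarrow> real mat) \<Rightarrow> bool" where
  "array_controllable q n p A B \<longleftrightarrow>
     (\<forall>x0. (\<forall>i<q. x0 i \<in> carrier_vec n) \<longrightarrow>
       (\<exists>\<tau>>0. \<exists>u x.
          (\<forall>\<sigma><p. set_integrable lebesgue {0..\<tau>} (u \<sigma>)) \<and>
          (\<forall>i<q. array_solution n p A (B i) \<tau> u (x0 i) (x i)) \<and>
          (\<forall>i<q. \<forall>j<q. x i \<tau> = x j \<tau>)))"

definition sync_space :: "nat \<Rightarrow> nat \<Rightarrow> 'a::conjugatable_field vec set" where
  "sync_space q d = mat_range (kronecker (mat q 1 (\<lambda>_. 1)) (1\<^sub>m d))"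

definition sync_perp :: "nat \<Rightarrow> nat \<Rightarrow> 'a::conjugatable_field vec set" where
  "sync_perp q d = {v \<in> carrier_vec (q * d). \<forall>w\<in>sync_space q d. v \<bullet>c w = 0}"

definition class_G :: "nat \<Rightarrow> nat \<Rightarrow> 'a::conjugatable_field mat set" where
  "class_G q d = {G. dim_row G = q * d \<and> mat_range G \<subseteq> sync_perp q d}"

text \<open>Ranges and orthogonal complements are over the field of the entries, so over the reals for
  the controllability matrix and over the complex numbers for the eigenvector matrices.\<close>

definition connected_mat :: "nat \<Rightarrow> nat \<Rightarrow> 'a::conjugatable_field mat \<Rightarrow> bool" where
  "connected_mat q d G \<longleftrightarrow> G \<in> class_G q d \<and> sync_perp q d \<subseteq> mat_range G"

end

theory Submission
  imports Defs
begin

text \<open>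
  Every condition says that no \<^emph>\<open>hidden mode\<close> exists. A hidden mode at \<open>\<mu>\<close> is a nonzero
  family \<open>z\<^sub>1, \<dots>, z\<^sub>q\<close> of vectors with \<open>A\<^sup>* z\<^sub>i = \<mu> z\<^sub>i\<close> for all \<open>i\<close>, with
  \<open>\<Sum> z\<^sub>i = 0\<close>, and with \<open>\<Sum> z\<^sub>i\<^sup>* B\<^sub>i\<^sub>\<sigma> = 0\<close> for all \<open>\<sigma>\<close>: the functional
  \<open>y = \<Sum> z\<^sub>i\<^sup>* x\<^sub>i\<close> measures disagreement, since it vanishes on synchronized states, and
  no input acts on it. The theorem is the closed chain controllable \<open>\<Longrightarrow>\<close> no hidden mode
  \<open>\<Longrightarrow>\<close> controllability matrix connected \<open>\<Longrightarrow>\<close> controllable, together with a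
  translation of hidden modes into the matrices \<open>inc (V\<^sub>\<kappa>\<^sup>* B)\<close>.

  \<^item> \<open>hidden_mode_imp_not_controllable\<close>: along every trajectory the number \<open>y\<close> obeys the scalar
    equation \<open>y' = cnj \<mu> y\<close>, so if it is nonzero initially it is nonzero forever, and the states
    never agree.

  \<^item> \<open>disconnected_ctrb_imp_hidden_mode\<close>: if the controllability matrix is not connected, some
    nonzero \<open>z\<close> in the complement of the synchronization space is orthogonal to its range. By
    Cayley-Hamilton \<open>z\<close> is orthogonal to \<open>A\<^sup>k B\<close> for all \<open>k\<close>, so the space of such \<open>z\<close>
    is invariant under \<open>A\<^sup>*\<close> acting on every block, and a nonzero invariant space contains an
    eigenvector.

  \<^item> \<open>connected_ctrb_imp_controllable\<close>: let the array run freely up to time 1; the deviations of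
    the resulting states from their mean lie in the complement of the synchronization space, hence
    in the range of the controllability matrix, so it suffices to reach each column
    \<open>A\<^sup>k B\<^sub>\<sigma>\<close> from rest. This is done with polynomial inputs, using that
    for any polynomial \<open>\<psi>\<close> the input \<open>\<chi>(D) \<psi>\<close>, where \<open>\<chi>\<close> is the
    characteristic polynomial of \<open>A\<close> and \<open>D\<close> is differentiation, produces an explicit
    trajectory in terms of derivatives of \<open>\<psi>\<close>.

  \<^item> \<open>connected_inc_iff_no_hidden_mode\<close>: the eigenvectors \<open>z\<^sub>i\<close> are exactly \<open>V\<^sub>\<kappa> w\<^sub>i\<close>
    with unique \<open>w\<^sub>i\<close>, so hidden modes at \<open>\<mu>\<^sub>\<kappa>\<close> correspond to nonzero vectors \<open>w\<close> in the
    complement of the synchronization space that are orthogonal to the range of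
    \<open>inc (V\<^sub>\<kappa>\<^sup>* B)\<close>.
\<close>

section \<open>Block vectors, orthogonality and connectedness\<close>

lemma mult_mat_vec_index_sum:
  assumes "M \<in> carrier_mat nr nc" "v \<in> carrier_vec nc" "i < nr"
  shows "(M *\<^sub>v v) $ i = (\<Sum>j<nc. M $$ (i, j) * v $ j)"
  using assms by (auto simp: scalar_prod_def atLeast0LessThan intro!: sum.cong)

lemma mult_mat_index_sum:
  assumes "M \<in> carrier_mat nr nc" "N \<in> carrier_mat nc nk" "i < nr" "j < nk"
  shows "(M * N) $$ (i, j) = (\<Sum>k<nc. M $$ (i, k) * N $$ (k, j))"
  using assms by (auto simp: scalar_prod_def atLeast0LessThan intro!: sum.cong)

lemma mat_adjoint_carrier:
  "M \<in> carrier_mat nr nc \<Longrightarrow> mat_adjoint M \<in> carrier_mat nc nr"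
  by (auto simp: mat_adjoint_def mat_of_rows_def)

lemma mat_adjoint_index:
  assumes "M \<in> carrier_mat nr nc" "i < nc" "j < nr"
  shows "mat_adjoint M $$ (i, j) = conjugate (M $$ (j, i))"
  using assms by (auto simp: mat_adjoint_def mat_of_rows_def)

lemma block_index_less: "i < q \<Longrightarrow> k < d \<Longrightarrow> i * d + k < q * d" for i q k d :: nat
  using mult_le_mono1[of "Suc i" q d] by simp

lemma sum_blocks: "(\<Sum>a<q * d. f a) = (\<Sum>i<q. \<Sum>k<d. f (i * d + k))" for q d :: nat
proof -
  have "(\<Sum>a<q * d. f a) = (\<Sum>i<q. sum f {i * d..<i * d + d})"
    by (rule sum.nat_group[symmetric])
  also have "\<dots> = (\<Sum>i<q. \<Sum>k<d. f (i * d + k))"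
  proof (rule sum.cong[OF refl])
    fix i
    show "sum f {i * d..<i * d + d} = (\<Sum>k<d. f (i * d + k))"
      using sum.shift_bounds_nat_ivl[of f 0 "i * d" d]
      by (simp add: atLeast0LessThan add.commute)
  qed
  finally show ?thesis .
qed

text \<open>
  Pairing a vector with \<open>(1 \<otimes> I) x\<close> gives the inner product of its block
  sum with \<open>x\<close>, so being orthogonal to the synchronization space means that the
  blocks add up to zero.
\<close>

lemma sync_perp_iff:
  fixes v :: "'a::conjugatable_field vec"
  shows "v \<in> sync_perp q d \<longleftrightarrow>
    v \<in> carrier_vec (q * d) \<and> (\<forall>k<d. (\<Sum>i<q. v $ (i * d + k)) = 0)"
proof -
  define K :: "'a mat" where "K = kronecker (mat q 1 (\<lambda>_. 1)) (1\<^sub>m d)"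
  have K: "K \<in> carrier_mat (q * d) d" by (simp add: K_def kronecker_def)
  have Kx: "(K *\<^sub>v x) $ (i * d + k) = x $ k"
    if x: "x \<in> carrier_vec d" and ik: "i < q" "k < d" for x i k
  proof -
    have "(K *\<^sub>v x) $ (i * d + k) = (\<Sum>l<d. K $$ (i * d + k, l) * x $ l)"
      by (rule mult_mat_vec_index_sum[OF K x block_index_less[OF ik]])
    also have "\<dots> = (\<Sum>l<d. if l = k then x $ l else 0)"
      using ik block_index_less[OF ik]
      by (intro sum.cong) (auto simp: K_def kronecker_def)
    finally show ?thesis using ik by simp
  qed
  have inner: "v \<bullet>c (K *\<^sub>v x) = (\<Sum>k<d. conjugate (x $ k) * (\<Sum>i<q. v $ (i * d + k)))"
    if x: "x \<in> carrier_vec d" and v: "v \<in> carrier_vec (q * d)" for x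
  proof -
    have "v \<bullet>c (K *\<^sub>v x) = (\<Sum>a<q * d. v $ a * conjugate ((K *\<^sub>v x) $ a))"
      using K v by (auto simp: scalar_prod_def atLeast0LessThan intro!: sum.cong)
    also have "\<dots> = (\<Sum>i<q. \<Sum>k<d. v $ (i * d + k) * conjugate (x $ k))"
      unfolding sum_blocks using Kx[OF x] by (intro sum.cong) auto
    also have "\<dots> = (\<Sum>k<d. \<Sum>i<q. v $ (i * d + k) * conjugate (x $ k))"
      by (rule sum.swap)
    finally show ?thesis by (simp add: sum_distrib_left mult.commute)
  qed
  have space: "sync_space q d = (\<lambda>x. K *\<^sub>v x) ` carrier_vec d"
    using K by (simp add: sync_space_def mat_range_def K_def)
  show ?thesis
  proof
    assume "v \<in> sync_perp q d"
    then have v: "v \<in> carrier_vec (q * d)" by (simp add: sync_perp_def)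
    have orth: "v \<bullet>c (K *\<^sub>v x) = 0" if "x \<in> carrier_vec d" for x
      using that \<open>v \<in> sync_perp q d\<close> by (auto simp: sync_perp_def space)
    have "(\<Sum>i<q. v $ (i * d + k)) = 0" if k: "k < d" for k
    proof -
      have unit: "unit_vec d k \<in> carrier_vec d" by simp
      have "(\<Sum>l<d. conjugate (unit_vec d k $ l) * (\<Sum>i<q. v $ (i * d + l))) = 0"
        using orth[OF unit] by (simp only: inner[OF unit v])
      also have "(\<Sum>l<d. conjugate (unit_vec d k $ l) * (\<Sum>i<q. v $ (i * d + l)))
          = (\<Sum>l<d. if l = k then conjugate 1 * (\<Sum>i<q. v $ (i * d + l)) else 0)"
        by (intro sum.cong) (auto simp: unit_vec_def)
      finally show ?thesis using k by simp
    qed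
    with v show "v \<in> carrier_vec (q * d) \<and> (\<forall>k<d. (\<Sum>i<q. v $ (i * d + k)) = 0)" by auto
  next
    assume "v \<in> carrier_vec (q * d) \<and> (\<forall>k<d. (\<Sum>i<q. v $ (i * d + k)) = 0)"
    then show "v \<in> sync_perp q d" by (auto simp: sync_perp_def space inner)
  qed
qed

text \<open>
  It is enough that the columns have vanishing block sums, because the complement of the
  synchronization space is a subspace.
\<close>

lemma class_GI:
  fixes G :: "'a::conjugatable_field mat"
  assumes row: "dim_row G = q * d"
    and cols: "\<And>j k. j < dim_col G \<Longrightarrow> k < d \<Longrightarrow> (\<Sum>i<q. G $$ (i * d + k, j)) = 0"
  shows "G \<in> class_G q d"
proof -
  define c where "c = dim_col G"
  have G: "G \<in> carrier_mat (q * d) c" using row by (auto simp: c_def)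
  have "G *\<^sub>v x \<in> sync_perp q d" if x: "x \<in> carrier_vec (c)" for x
  proof -
    have "(\<Sum>i<q. (G *\<^sub>v x) $ (i * d + k)) = 0" if k: "k < d" for k
    proof -
      have "(\<Sum>i<q. (G *\<^sub>v x) $ (i * d + k))
          = (\<Sum>i<q. \<Sum>j<c. G $$ (i * d + k, j) * x $ j)"
        using k by (intro sum.cong refl mult_mat_vec_index_sum[OF G x] block_index_less) auto
      also have "\<dots> = (\<Sum>j<c. (\<Sum>i<q. G $$ (i * d + k, j)) * x $ j)"
        by (subst sum.swap) (simp add: sum_distrib_right)
      finally show ?thesis using cols k by (simp add: c_def)
    qed
    moreover have "G *\<^sub>v x \<in> carrier_vec (q * d)" by (rule mult_mat_vec_carrier[OF G x])
    ultimately show ?thesis by (simp add: sync_perp_iff del: index_mult_mat_vec)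
  qed
  then show ?thesis using row by (auto simp: class_G_def mat_range_def c_def)
qed

text \<open>
  Existence of the orthogonal projection of \<open>y\<close> onto the span of the vectors
  \<open>g 0, \<dots>, g (c - 1)\<close>. One Gram-Schmidt step extends the span by the next
  vector: \<open>e\<close> is that vector minus its projection, and the old residual
  \<open>r\<close> is corrected along \<open>e\<close>. If \<open>e = 0\<close>, the next vector
  already lies in the span, the coefficient \<open>s\<close> is 0 as a division by zero, and the
  old residual remains valid.
\<close>

lemma least_squares_exists:
  fixes g :: "nat \<Rightarrow> nat \<Rightarrow> 'a::conjugatable_ordered_field"
  shows "\<exists>x. \<forall>j<c. (\<Sum>a<N. (y a - (\<Sum>l<c. g a l * x l)) * conjugate (g a j)) = 0"
proof (induction c arbitrary: y)
  case (Suc c)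
  define ip where "ip u v = (\<Sum>a<N. u a * conjugate (v a))" for u v :: "nat \<Rightarrow> 'a"
  have ip_diff: "ip (\<lambda>a. u a - s * w a) v = ip u v - s * ip w v" for u w v s
    by (simp add: ip_def algebra_simps sum_subtractf sum_distrib_left)
  have IH: "\<exists>x. \<forall>j<c. ip (\<lambda>a. y a - (\<Sum>l<c. g a l * x l)) (\<lambda>a. g a j) = 0" for y
    using Suc.IH by (simp add: ip_def)
  obtain x' where x': "\<And>j. j < c \<Longrightarrow> ip (\<lambda>a. g a c - (\<Sum>l<c. g a l * x' l)) (\<lambda>a. g a j) = 0"
    using IH[of "\<lambda>a. g a c"] by blast
  obtain x where x: "\<And>j. j < c \<Longrightarrow> ip (\<lambda>a. y a - (\<Sum>l<c. g a l * x l)) (\<lambda>a. g a j) = 0"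
    using IH[of y] by blast
  define e where "e a = g a c - (\<Sum>l<c. g a l * x' l)" for a
  define r where "r a = y a - (\<Sum>l<c. g a l * x l)" for a
  define s where "s = ip r e / ip e e"
  \<comment> \<open>A vector orthogonal to the first \<open>c\<close> vectors sees the next one only through \<open>e\<close>.\<close>
  have e_span: "ip u (\<lambda>a. g a c) = ip u e" if "\<And>j. j < c \<Longrightarrow> ip u (\<lambda>a. g a j) = 0" for u
  proof -
    have "ip u (\<lambda>a. g a c) - ip u e = (\<Sum>a<N. u a * conjugate (\<Sum>l<c. g a l * x' l))"
    proof -
      have g: "g a c = e a + (\<Sum>l<c. g a l * x' l)" for a by (simp add: e_def)
      show ?thesis
        unfolding ip_def by (simp add: g conjugate_dist_add distrib_left sum.distrib)
    qed
    also have "\<dots> = (\<Sum>l<c. conjugate (x' l) * ip u (\<lambda>a. g a l))"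
      by (simp add: sum_conjugate conjugate_dist_mul ip_def sum_distrib_left)
         (subst sum.swap, simp add: algebra_simps)
    finally show ?thesis using that by simp
  qed
  \<comment> \<open>The new residual \<open>r - s e\<close>, expressed through the original vectors.\<close>
  have res: "(\<lambda>a. y a - (\<Sum>l<Suc c. g a l * (if l = c then s else x l - s * x' l)))
      = (\<lambda>a. r a - s * e a)"
    by (auto simp: r_def e_def algebra_simps sum_subtractf sum_distrib_left)
  have orth: "ip (\<lambda>a. r a - s * e a) (\<lambda>a. g a j) = 0" if "j < c" for j
    using x[OF that] x'[OF that] by (simp add: ip_diff r_def[symmetric] e_def[symmetric])
  have "ip (\<lambda>a. r a - s * e a) e = 0"
  proof (cases "ip e e = 0")
    case True
    then have "\<forall>a<N. e a = 0"
      unfolding ip_def by (subst (asm) sum_nonneg_eq_0_iff) (auto simp: conjugate_square_positive)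
    then show ?thesis by (simp add: ip_def)
  qed (simp only: ip_diff, simp add: s_def)
  then have "ip (\<lambda>a. r a - s * e a) (\<lambda>a. g a j) = 0" if "j < Suc c" for j
    using that orth e_span[OF orth] by (cases "j = c") auto
  then have "\<forall>j<Suc c. ip (\<lambda>a. r a - s * e a) (\<lambda>a. g a j) = 0" by simp
  then show ?case unfolding res[symmetric] ip_def
    by (intro exI[where x = "\<lambda>l. if l = c then s else x l - s * x' l"])
qed auto

text \<open>
  Duality: a vector of the complement outside the range has a nonzero residual after projection
  onto the range, and this residual is a vector of the complement that is orthogonal to the
  range. Connectedness can thus be refuted by exhibiting a single orthogonal vector.
\<close>

lemma connected_mat_iff_orthogonal:
  fixes G :: "'a::conjugatable_ordered_field mat"
  assumes G: "G \<in> class_G q d"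
  shows "connected_mat q d G \<longleftrightarrow>
    (\<forall>z\<in>sync_perp q d. (\<forall>j<dim_col G. (\<Sum>a<q * d. z $ a * conjugate (G $$ (a, j))) = 0) \<longrightarrow>
       (\<forall>a<q * d. z $ a = 0))"
proof -
  define c where "c = dim_col G"
  have Gc: "G \<in> carrier_mat (q * d) c" and range: "mat_range G \<subseteq> sync_perp q d"
    using G by (auto simp: class_G_def c_def)
  note Gx = mult_mat_vec_index_sum[OF Gc]
  show ?thesis
  unfolding c_def[symmetric]
  proof (intro iffI ballI impI)
    fix z :: "'a vec"
    assume con: "connected_mat q d G" and z: "z \<in> sync_perp q d"
      and orth: "\<forall>j<c. (\<Sum>a<q * d. z $ a * conjugate (G $$ (a, j))) = 0"
    from con z obtain x where x: "x \<in> carrier_vec c" and zx: "z = G *\<^sub>v x"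
      by (auto simp: connected_mat_def mat_range_def c_def)
    have "(\<Sum>a<q * d. z $ a * conjugate (z $ a))
        = (\<Sum>a<q * d. z $ a * conjugate (\<Sum>j<c. G $$ (a, j) * x $ j))"
      using Gx[OF x] by (intro sum.cong) (auto simp: zx)
    also have "\<dots> = (\<Sum>j<c. conjugate (x $ j) * (\<Sum>a<q * d. z $ a * conjugate (G $$ (a, j))))"
      by (simp add: sum_conjugate conjugate_dist_mul sum_distrib_left)
         (subst sum.swap, simp add: algebra_simps)
    finally have "(\<Sum>a<q * d. z $ a * conjugate (z $ a)) = 0" using orth by simp
    then show "\<forall>a<q * d. z $ a = 0"
      by (subst (asm) sum_nonneg_eq_0_iff) (auto simp: conjugate_square_positive)
  next
    assume triv: "\<forall>z\<in>sync_perp q d.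
      (\<forall>j<c. (\<Sum>a<q * d. z $ a * conjugate (G $$ (a, j))) = 0) \<longrightarrow> (\<forall>a<q * d. z $ a = 0)"
    have "y \<in> mat_range G" if y: "y \<in> sync_perp q d" for y
    proof -
      have "\<exists>x. \<forall>j<c. (\<Sum>a<q * d.
          (y $ a - (\<Sum>l<c. G $$ (a, l) * x l)) * conjugate (G $$ (a, j))) = 0"
        by (rule least_squares_exists)
      then obtain x where x: "\<forall>j<c. (\<Sum>a<q * d.
          (y $ a - (\<Sum>l<c. G $$ (a, l) * x l)) * conjugate (G $$ (a, j))) = 0"
        by (rule exE)
      let ?x = "vec c x"
      have Gx': "(G *\<^sub>v ?x) $ a = (\<Sum>l<c. G $$ (a, l) * x l)" if "a < q * d" for a
        using Gx[of ?x, OF _ that] by simp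
      have yc: "y \<in> carrier_vec (q * d)" using y by (simp add: sync_perp_iff)
      have "G *\<^sub>v ?x \<in> sync_perp q d" using range by (auto simp: mat_range_def c_def)
      then have perp: "y - G *\<^sub>v ?x \<in> sync_perp q d"
        using y Gc by (simp add: sync_perp_iff block_index_less sum_subtractf del: index_mult_mat_vec)
      have "(\<Sum>a<q * d. (y - G *\<^sub>v ?x) $ a * conjugate (G $$ (a, j))) = 0" if "j < c" for j
      proof -
        have "(y - G *\<^sub>v ?x) $ a = y $ a - (\<Sum>l<c. G $$ (a, l) * x l)" if "a < q * d" for a
          using that Gc yc by (simp add: Gx' del: index_mult_mat_vec)
        then show ?thesis using x that by simp
      qed
      then have "\<forall>a<q * d. (y - G *\<^sub>v ?x) $ a = 0"
        by (intro triv[THEN bspec, OF perp, THEN mp] allI impI)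
      then have "y = G *\<^sub>v ?x" using yc Gc by (intro eq_vecI) auto
      then show ?thesis by (auto simp: mat_range_def c_def)
    qed
    then show "connected_mat q d G" using G by (auto simp: connected_mat_def)
  qed
qed

text \<open>
  Equality of the rank with the number of columns forces the columns to be pairwise distinct, so
  that the set of columns is as large as their list and its linear independence is that of the
  family.
\<close>

lemma full_column_rank_injective:
  fixes V :: "'a::field mat"
  assumes V: "V \<in> carrier_mat n d" and rank: "vec_space.rank n V = d"
    and v: "v \<in> carrier_vec d" and Vv: "V *\<^sub>v v = 0\<^sub>v n"
  shows "v = 0\<^sub>v d"
proof -
  interpret vec_space "TYPE('a)" n .
  have len: "length (cols V) = d" using V by simp
  have fin: "finite (set (cols V))" by simp
  \<comment> \<open>The rank is the size of a largest independent set of columns.\<close>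
  obtain S where S: "maximal S (\<lambda>T. T \<subseteq> set (cols V) \<and> lin_indpt T)"
    using maximal_exists[of "(\<lambda>T. T \<subseteq> set (cols V) \<and> lin_indpt T)" "card (set (cols V))" "{}"]
    by (meson List.finite_set card_mono empty_iff empty_subsetI finite_lin_indpt2 rev_finite_subset)
  then have "card S \<le> card (set (cols V))" by (simp add: card_mono maximal_def)
  then have "d \<le> card (set (cols V))" using rank_card_indpt[OF V S] rank by simp
  then have "distinct (cols V)" using len card_length[of "cols V"] by (intro card_distinct) simp
  then show ?thesis
    using lin_depI[OF V v _ Vv] full_rank_lin_indpt[OF V rank] by blast
qed

section \<open>The Cayley-Hamilton theorem\<close>

lemma char_poly_matrix_index:
  assumes "A \<in> carrier_mat n n" "r < n" "t < n"
  shows "char_poly_matrix A $$ (r, t) = (if r = t then [:0, 1:] else 0) + [:- (A $$ (r, t)):]"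
  using assms by (auto simp: char_poly_matrix_def)

text \<open>
  Write the adjugate of \<open>x I - A\<close> as a polynomial with matrix coefficients
  \<open>b\<^sub>k\<close>. Comparing coefficients in \<open>(x I - A) adj (x I - A) = \<chi>(x)
  I\<close> gives \<open>\<chi>\<^sub>k I = b\<^sub>k\<^sub>-\<^sub>1 - A b\<^sub>k\<close>;
  multiplied by \<open>A\<^sup>k\<close> from the left and summed over \<open>k\<close>, the
  right-hand side telescopes. Only the column \<open>s\<close> of these matrices is needed, so
  \<open>b k r\<close> carries no column index.
\<close>

lemma cayley_hamilton_entry:
  fixes A :: "'a::comm_ring_1 mat"
  assumes A: "A \<in> carrier_mat n n" and i: "i < n" and s: "s < n"
  shows "(\<Sum>k\<le>n. coeff (char_poly A) k * (A ^\<^sub>m k) $$ (i, s)) = 0"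
proof -
  define Q where "Q = adj_mat (char_poly_matrix A)"
  define b where "b k r = coeff (Q $$ (r, s)) k" for k r
  \<comment> \<open>The telescoping term: entry \<open>(i, s)\<close> of \<open>A\<^sup>k b\<^sub>k\<^sub>-\<^sub>1\<close>.\<close>
  define S where "S k = (case k of 0 \<Rightarrow> 0 | Suc j \<Rightarrow> \<Sum>r<n. (A ^\<^sub>m k) $$ (i, r) * b j r)" for k
  have P: "char_poly_matrix A \<in> carrier_mat n n" using A by simp
  have Q: "Q \<in> carrier_mat n n" using adj_mat(1)[OF P] by (simp add: Q_def)
  have pow: "A ^\<^sub>m k \<in> carrier_mat n n" for k using A by simp
  have "char_poly_matrix A * Q = char_poly A \<cdot>\<^sub>m 1\<^sub>m n"
    using adj_mat(2)[OF P] by (simp add: Q_def char_poly_def)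
  then have "(char_poly_matrix A * Q) $$ (r, s) = (if r = s then char_poly A else 0)" if "r < n" for r
    using that s by simp
  then have id: "(if r = s then char_poly A else 0)
      = pCons 0 (Q $$ (r, s)) - (\<Sum>t<n. Polynomial.smult (A $$ (r, t)) (Q $$ (t, s)))" if r: "r < n" for r
  proof -
    have "(if r = s then char_poly A else 0)
        = (\<Sum>t<n. char_poly_matrix A $$ (r, t) * Q $$ (t, s))"
      using \<open>\<And>r. r < n \<Longrightarrow> _ r\<close>[OF r] mult_mat_index_sum[OF P Q r s] by simp
    also have "\<dots> = (\<Sum>t<n. (if t = r then pCons 0 (Q $$ (t, s)) else 0)
        - Polynomial.smult (A $$ (r, t)) (Q $$ (t, s)))"
      by (intro sum.cong) (auto simp: char_poly_matrix_index[OF A r] algebra_simps)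
    also have "\<dots> = pCons 0 (Q $$ (r, s)) - (\<Sum>t<n. Polynomial.smult (A $$ (r, t)) (Q $$ (t, s)))"
      using r by (simp add: sum_subtractf)
    finally show ?thesis .
  qed
  have co: "(if r = s then coeff (char_poly A) k else 0)
      = (case k of 0 \<Rightarrow> 0 | Suc j \<Rightarrow> b j r) - (\<Sum>t<n. A $$ (r, t) * b k t)" if "r < n" for r k
    using arg_cong[OF id[OF that], of "\<lambda>f. coeff f k"]
    by (cases k) (simp_all add: b_def coeff_sum if_distrib[of "\<lambda>f. coeff f _"] cong: if_cong)
  have tele: "coeff (char_poly A) k * (A ^\<^sub>m k) $$ (i, s) = S k - S (Suc k)" for k
  proof -
    have "coeff (char_poly A) k * (A ^\<^sub>m k) $$ (i, s)
        = (\<Sum>r<n. (A ^\<^sub>m k) $$ (i, r) * (if r = s then coeff (char_poly A) k else 0))"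
      using s by (simp add: if_distrib mult.commute cong: if_cong)
    also have "\<dots> = (\<Sum>r<n. (A ^\<^sub>m k) $$ (i, r) * (case k of 0 \<Rightarrow> 0 | Suc j \<Rightarrow> b j r))
        - (\<Sum>r<n. \<Sum>t<n. (A ^\<^sub>m k) $$ (i, r) * A $$ (r, t) * b k t)"
      by (simp add: co right_diff_distrib sum_subtractf sum_distrib_left mult.assoc)
    also have "(\<Sum>r<n. (A ^\<^sub>m k) $$ (i, r) * (case k of 0 \<Rightarrow> 0 | Suc j \<Rightarrow> b j r)) = S k"
      by (cases k) (auto simp: S_def)
    also have "(\<Sum>r<n. \<Sum>t<n. (A ^\<^sub>m k) $$ (i, r) * A $$ (r, t) * b k t) = S (Suc k)"
      by (subst sum.swap)
        (simp add: S_def mult_mat_index_sum[OF pow A i] sum_distrib_right del: index_mult_mat)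
    finally show ?thesis .
  qed
  \<comment> \<open>Beyond \<open>N\<close> all coefficients of the adjugate vanish, so the telescoped sum has no upper end.\<close>
  define N where "N = n + (\<Sum>r<n. Suc (degree (Q $$ (r, s))))"
  have "b N r = 0" if "r < n" for r
  proof -
    have "Suc (degree (Q $$ (r, s))) \<le> N"
      unfolding N_def using that by (intro trans_le_add2 member_le_sum) auto
    then show ?thesis by (simp add: b_def coeff_eq_0)
  qed
  then have SN: "S (Suc N) = 0" by (simp add: S_def)
  have "(\<Sum>k\<le>n. coeff (char_poly A) k * (A ^\<^sub>m k) $$ (i, s))
      = (\<Sum>k\<le>N. coeff (char_poly A) k * (A ^\<^sub>m k) $$ (i, s))"
    using degree_monic_char_poly[OF A] by (intro sum.mono_neutral_left) (auto simp: N_def coeff_eq_0)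
  also have "\<dots> = (\<Sum>k\<le>N. S k - S (Suc k))" by (simp only: tele)
  also have "\<dots> = S 0 - S (Suc N)" by (rule sum_telescope)
  finally show ?thesis by (simp add: SN) (simp add: S_def)
qed

section \<open>Entries of the controllability matrix\<close>

lemma kronecker_one_index:
  assumes "M \<in> carrier_mat n n" "i < q" "r < n" "j < q" "s < n"
  shows "kronecker (1\<^sub>m q) M $$ (i * n + r, j * n + s) = (if i = j then M $$ (r, s) else 0)"
  using assms block_index_less[of i q r n] block_index_less[of j q s n]
  by (simp add: kronecker_def)

lemma kronecker_one_carrier:
  "M \<in> carrier_mat n n \<Longrightarrow> kronecker (1\<^sub>m q) M \<in> carrier_mat (q * n) (q * n)"
  by (simp add: kronecker_def)

lemma block_index_cases:
  fixes a :: nat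
  assumes "a < q * n"
  obtains i r where "i < q" "r < n" "a = i * n + r"
proof
  show "a div n < q" using assms by (simp add: less_mult_imp_div_less)
  show "a mod n < n" using assms by (cases n) auto
qed simp

lemma block_index_eq_iff:
  fixes i j n r s :: nat
  assumes "r < n" "s < n"
  shows "i * n + r = j * n + s \<longleftrightarrow> i = j \<and> r = s"
proof
  assume eq: "i * n + r = j * n + s"
  have "(i * n + r) div n = i" "(j * n + s) div n = j" using assms by auto
  then have "i = j" using eq by simp
  then show "i = j \<and> r = s" using eq by simp
qed auto

lemma kronecker_one_mult:
  assumes M: "M \<in> carrier_mat n n" and N: "N \<in> carrier_mat n n"
  shows "kronecker (1\<^sub>m q) M * kronecker (1\<^sub>m q) N = kronecker (1\<^sub>m q) (M * N)" (is "?L = ?R")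
proof (rule eq_matI)
  have MN: "M * N \<in> carrier_mat n n" using M N by simp
  fix a c assume "a < dim_row ?R" "c < dim_col ?R"
  then have "a < q * n" "c < q * n" using kronecker_one_carrier[OF MN, of q] by auto
  then obtain i r j s where ix: "i < q" "r < n" "j < q" "s < n" "a = i * n + r" "c = j * n + s"
    by (metis block_index_cases)
  have "?L $$ (a, c) = (\<Sum>l<q. \<Sum>t<n. kronecker (1\<^sub>m q) M $$ (a, l * n + t)
      * kronecker (1\<^sub>m q) N $$ (l * n + t, c))"
    by (subst mult_mat_index_sum[OF kronecker_one_carrier[OF M] kronecker_one_carrier[OF N]])
      (use ix block_index_less in \<open>auto simp: sum_blocks\<close>)
  also have "\<dots> = (\<Sum>l<q. if l = i then (\<Sum>t<n. if l = j then M $$ (r, t) * N $$ (t, s) else 0) else 0)"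
    using ix by (intro sum.cong) (auto simp: kronecker_one_index[OF M] kronecker_one_index[OF N] intro!: sum.cong)
  also have "\<dots> = ?R $$ (a, c)"
    using ix kronecker_one_index[OF MN ix(1-4)]
    by (simp add: mult_mat_index_sum[OF M N] del: index_mult_mat)
  finally show "?L $$ (a, c) = ?R $$ (a, c)" .
qed (use M N in \<open>auto simp: kronecker_def\<close>)

lemma kronecker_one_pow:
  assumes A: "A \<in> carrier_mat n n"
  shows "kronecker (1\<^sub>m q) A ^\<^sub>m k = kronecker (1\<^sub>m q) (A ^\<^sub>m k)"
proof (induction k)
  case 0
  show ?case
  proof (rule eq_matI)
    fix a c assume "a < dim_row (kronecker (1\<^sub>m q) (A ^\<^sub>m 0))" "c < dim_col (kronecker (1\<^sub>m q) (A ^\<^sub>m 0))"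
    then have "a < q * n" "c < q * n" using A by (auto simp: kronecker_def)
    then obtain i r j s where "i < q" "r < n" "j < q" "s < n" "a = i * n + r" "c = j * n + s"
      by (metis block_index_cases)
    then show "(kronecker (1\<^sub>m q) A ^\<^sub>m 0) $$ (a, c) = kronecker (1\<^sub>m q) (A ^\<^sub>m 0) $$ (a, c)"
      using A \<open>a < q * n\<close> \<open>c < q * n\<close> kronecker_one_index[of "1\<^sub>m n" n i q r j s]
      by (auto simp: block_index_eq_iff kronecker_def)
  qed (use A in \<open>auto simp: kronecker_def\<close>)
next
  case (Suc k)
  then show ?case using A by (simp add: kronecker_one_mult[where n = n])
qed

text \<open>
  The Markov parameters \<open>A\<^sup>k B\<^sub>i\<^sub>\<sigma>\<close>, by entries. Their
  stacks over \<open>i\<close> are the columns of the controllability matrix.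
\<close>

definition markov :: "nat \<Rightarrow> 'a::comm_ring_1 mat \<Rightarrow> (nat \<Rightarrow> nat \<Rightarrow> 'a mat) \<Rightarrow> nat \<Rightarrow> nat \<Rightarrow> nat \<Rightarrow> nat \<Rightarrow> 'a"
  where "markov n A B k i \<sigma> r = (\<Sum>t<n. (A ^\<^sub>m k) $$ (r, t) * B i \<sigma> $$ (t, 0))"

lemma ctrb_matrix_index:
  assumes A: "A \<in> carrier_mat n n" and ix: "i < q" "r < n" "k < n" "\<sigma> < p"
  shows "ctrb_matrix q n p A B $$ (i * n + r, k * p + \<sigma>) = markov n A B k i \<sigma> r"
proof -
  let ?K = "kronecker (1\<^sub>m q) (A ^\<^sub>m k)"
  have pow: "A ^\<^sub>m k \<in> carrier_mat n n" using A by simp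
  have incB: "inc q p n 1 B \<in> carrier_mat (q * n) p" by (simp add: inc_def)
  have "ctrb_matrix q n p A B $$ (i * n + r, k * p + \<sigma>) = (?K * inc q p n 1 B) $$ (i * n + r, \<sigma>)"
    using ix block_index_less[OF ix(1,2)] block_index_less[OF ix(3,4)]
    by (simp add: ctrb_matrix_def kronecker_one_pow[OF A])
  also have "\<dots> = (\<Sum>l<q. \<Sum>t<n. ?K $$ (i * n + r, l * n + t) * inc q p n 1 B $$ (l * n + t, \<sigma>))"
    by (subst mult_mat_index_sum[OF kronecker_one_carrier[OF pow] incB])
      (use ix block_index_less in \<open>auto simp: sum_blocks\<close>)
  also have "\<dots> = (\<Sum>l<q. if l = i then markov n A B k i \<sigma> r else 0)"
    using ix block_index_less
    by (intro sum.cong) (auto simp: kronecker_one_index[OF pow] markov_def inc_def)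
  finally show ?thesis using ix by simp
qed

lemma pow_mat_Suc_left:
  assumes A: "A \<in> carrier_mat n n"
  shows "A ^\<^sub>m Suc k = A * A ^\<^sub>m k"
proof (induction k)
  case (Suc k)
  have "A ^\<^sub>m Suc (Suc k) = A * A ^\<^sub>m k * A" using Suc by simp
  also have "\<dots> = A * (A ^\<^sub>m k * A)" using A by (intro assoc_mult_mat) auto
  finally show ?case by simp
qed (use A in auto)

lemma markov_0:
  assumes "A \<in> carrier_mat n n" "r < n"
  shows "markov n A B 0 i \<sigma> r = B i \<sigma> $$ (r, 0)"
proof -
  have "markov n A B 0 i \<sigma> r = (\<Sum>t<n. if t = r then B i \<sigma> $$ (t, 0) else 0)"
    unfolding markov_def using assms by (intro sum.cong) auto
  then show ?thesis using assms by simp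
qed

lemma markov_Suc:
  assumes A: "A \<in> carrier_mat n n" and r: "r < n"
  shows "markov n A B (Suc k) i \<sigma> r = (\<Sum>s<n. A $$ (r, s) * markov n A B k i \<sigma> s)"
proof -
  have pow: "A ^\<^sub>m k \<in> carrier_mat n n" using A by simp
  have "markov n A B (Suc k) i \<sigma> r
      = (\<Sum>t<n. \<Sum>s<n. A $$ (r, s) * (A ^\<^sub>m k) $$ (s, t) * B i \<sigma> $$ (t, 0))"
    unfolding markov_def pow_mat_Suc_left[OF A]
    by (intro sum.cong) (simp_all add: mult_mat_index_sum[OF A pow r] sum_distrib_right del: index_mult_mat)
  then show ?thesis
    by (subst (asm) sum.swap) (simp add: markov_def sum_distrib_left mult.assoc)
qed

text \<open>
  The shift by \<open>m\<close> turns Cayley-Hamilton into a recurrence that expresses every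
  Markov parameter of index at least \<open>n\<close> through the \<open>n\<close> preceding
  ones.
\<close>

lemma markov_cayley_hamilton:
  assumes A: "A \<in> carrier_mat n n" and r: "r < n"
  shows "(\<Sum>l\<le>n. coeff (char_poly A) l * markov n A B (l + m) i \<sigma> r) = 0"
  using r
proof (induction m arbitrary: r)
  case 0
  have "(\<Sum>l\<le>n. coeff (char_poly A) l * markov n A B l i \<sigma> r)
      = (\<Sum>t<n. (\<Sum>l\<le>n. coeff (char_poly A) l * (A ^\<^sub>m l) $$ (r, t)) * B i \<sigma> $$ (t, 0))"
    unfolding markov_def sum_distrib_left sum_distrib_right by (subst sum.swap) (simp add: mult.assoc)
  then show ?case using cayley_hamilton_entry[OF A] 0 by simp
next
  case (Suc m)
  have "(\<Sum>l\<le>n. coeff (char_poly A) l * markov n A B (l + Suc m) i \<sigma> r)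
      = (\<Sum>s<n. A $$ (r, s) * (\<Sum>l\<le>n. coeff (char_poly A) l * markov n A B (l + m) i \<sigma> s))"
    by (simp add: markov_Suc[OF A \<open>r < n\<close>] sum_distrib_left) (subst sum.swap, simp add: algebra_simps)
  then show ?case using Suc by simp
qed

lemma markov_sum_zero:
  assumes "relative_actuation q n p B" "\<sigma> < p"
  shows "(\<Sum>i<q. markov n A B k i \<sigma> r) = 0"
proof -
  have "(\<Sum>i<q. markov n A B k i \<sigma> r) = (\<Sum>t<n. (A ^\<^sub>m k) $$ (r, t) * (\<Sum>i<q. B i \<sigma> $$ (t, 0)))"
    unfolding markov_def sum_distrib_left by (rule sum.swap)
  then show ?thesis using assms by (simp add: relative_actuation_def)
qed

lemma ctrb_matrix_class_G:
  assumes A: "A \<in> carrier_mat n n" and rel: "relative_actuation q n p B"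
  shows "ctrb_matrix q n p A B \<in> class_G q n"
proof (rule class_GI)
  fix j k assume j: "j < dim_col (ctrb_matrix q n p A B)" and k: "k < n"
  then have "j < n * p" by (simp add: ctrb_matrix_def)
  then obtain l \<sigma> where "l < n" "\<sigma> < p" "j = l * p + \<sigma>" by (rule block_index_cases)
  then show "(\<Sum>i<q. ctrb_matrix q n p A B $$ (i * n + k, j)) = 0"
    using markov_sum_zero[OF rel] by (simp add: ctrb_matrix_index[OF A _ k])
qed (simp add: ctrb_matrix_def)

section \<open>Hidden modes of a disconnected controllability matrix\<close>

text \<open>
  Peel off one root \<open>l\<close> of the annihilating polynomial at a time: either
  \<open>Z\<close> is an eigenvector for \<open>l\<close> or \<open>(T - l) Z\<close> is a
  nonzero member of the invariant set, annihilated by the cofactor of degree one less. Functions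
  matter only on \<open>X\<close>, which lets the operator be defined on index pairs without
  bounds.
\<close>

lemma invariant_eigenvector_exists:
  fixes T :: "('b \<Rightarrow> complex) \<Rightarrow> 'b \<Rightarrow> complex" and I :: "('b \<Rightarrow> complex) \<Rightarrow> bool"
  assumes lin: "\<And>f g c. T (\<lambda>x. f x - c * g x) = (\<lambda>x. T f x - c * T g x)"
    and inv: "\<And>f c. I f \<Longrightarrow> I (\<lambda>x. T f x - c * f x)"
    and f: "f \<noteq> 0" and Z: "I Z" and nz: "\<exists>x\<in>X. Z x \<noteq> 0"
    and ann: "\<And>x. x \<in> X \<Longrightarrow> (\<Sum>k\<le>degree f. coeff f k * (T ^^ k) Z x) = 0"
  shows "\<exists>\<mu> Y. I Y \<and> (\<exists>x\<in>X. Y x \<noteq> 0) \<and> (\<forall>x\<in>X. T Y x = \<mu> * Y x)"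
  using f Z nz ann
proof (induction "degree f" arbitrary: f Z)
  case 0
  then have "coeff f 0 \<noteq> 0" by (metis leading_coeff_0_iff)
  with 0 show ?case by auto
next
  case (Suc dg)
  from Suc.hyps(2) have "\<not> constant (poly f)"
    by (simp add: constant_degree)
  then obtain l where "poly f l = 0" using fundamental_theorem_of_algebra by blast
  then obtain g where fg: "f = [:- l, 1:] * g" by (metis dvdE poly_eq_0_iff_dvd)
  have g: "g \<noteq> 0" using Suc.prems(1) fg by auto
  have deg: "degree f = Suc (degree g)" using g by (simp add: fg degree_mult_eq del: mult_pCons_left)
  define Z' where "Z' = (\<lambda>x. T Z x - l * Z x)"
  show ?case
  proof (cases "\<exists>x\<in>X. Z' x \<noteq> 0")
    case False
    then show ?thesis using Suc.prems(2,3) by (intro exI[of _ l] exI[of _ Z]) (auto simp: Z'_def)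
  next
    case True
    have iter: "(T ^^ k) Z' = (\<lambda>x. (T ^^ Suc k) Z x - l * (T ^^ k) Z x)" for k
      by (induction k) (simp_all add: Z'_def lin)
    have "(\<Sum>k\<le>degree g. coeff g k * (T ^^ k) Z' x) = 0" if x: "x \<in> X" for x
    proof -
      let ?s = "\<lambda>k. (T ^^ k) Z x" and ?d = "degree g"
      have "0 = (\<Sum>k\<le>Suc ?d. coeff f k * ?s k)" using Suc.prems(4)[OF x] deg by simp
      also have "\<dots> = (\<Sum>k\<le>Suc ?d. (case k of 0 \<Rightarrow> 0 | Suc j \<Rightarrow> coeff g j) * ?s k)
          - (\<Sum>k\<le>Suc ?d. l * coeff g k * ?s k)"
        unfolding sum_subtractf[symmetric] by (intro sum.cong) (auto simp: fg coeff_pCons algebra_simps split: nat.split)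
      also have "(\<Sum>k\<le>Suc ?d. (case k of 0 \<Rightarrow> 0 | Suc j \<Rightarrow> coeff g j) * ?s k)
          = (\<Sum>k\<le>?d. coeff g k * ?s (Suc k))"
        by (simp only: sum.atMost_Suc_shift) simp
      also have "(\<Sum>k\<le>Suc ?d. l * coeff g k * ?s k) = (\<Sum>k\<le>?d. l * coeff g k * ?s k)"
        by (simp add: coeff_eq_0)
      finally show ?thesis unfolding iter by (simp add: algebra_simps sum_subtractf)
    qed
    then show ?thesis
      using Suc.hyps(1)[of g Z'] Suc.hyps(2) deg g inv[OF Suc.prems(2), of l] True by (simp add: Z'_def)
  qed
qed

text \<open>
  The first condition is \<open>A\<^sup>* z\<^sub>i = \<mu> z\<^sub>i\<close>, with the real
  matrix \<open>A\<close> transposed through its indices. Only entries with indices in range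
  carry meaning.
\<close>

definition hidden_mode ::
  "nat \<Rightarrow> nat \<Rightarrow> nat \<Rightarrow> real mat \<Rightarrow> (nat \<Rightarrow> nat \<Rightarrow> real mat) \<Rightarrow> complex \<Rightarrow> (nat \<Rightarrow> nat \<Rightarrow> complex) \<Rightarrow> bool"
  where "hidden_mode q n p A B \<mu> z \<longleftrightarrow>
    (\<forall>i<q. \<forall>r<n. (\<Sum>s<n. of_real (A $$ (s, r)) * z i s) = \<mu> * z i r) \<and>
    (\<forall>r<n. (\<Sum>i<q. z i r) = 0) \<and>
    (\<forall>\<sigma><p. (\<Sum>i<q. \<Sum>r<n. cnj (z i r) * of_real (B i \<sigma> $$ (r, 0))) = 0) \<and>
    (\<exists>i<q. \<exists>r<n. z i r \<noteq> 0)"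

text \<open>
  The controllability matrix only involves powers below \<open>n\<close>, whereas invariance
  under \<open>A\<^sup>*\<close> needs orthogonality to all powers.
\<close>

lemma markov_annihilator_extends:
  fixes z :: "nat \<Rightarrow> nat \<Rightarrow> real"
  assumes A: "A \<in> carrier_mat n n"
    and z: "\<And>k. k < n \<Longrightarrow> (\<Sum>i<q. \<Sum>r<n. z i r * markov n A B k i \<sigma> r) = 0"
  shows "(\<Sum>i<q. \<Sum>r<n. z i r * markov n A B k i \<sigma> r) = 0"
proof (induction k rule: less_induct)
  case (less k)
  let ?s = "\<lambda>k. \<Sum>i<q. \<Sum>r<n. z i r * markov n A B k i \<sigma> r"
  show ?case
  proof (cases "k < n")
    case False
    define m where "m = k - n"
    have "(\<Sum>l\<le>n. coeff (char_poly A) l * ?s (l + m))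
        = (\<Sum>i<q. \<Sum>r<n. z i r * (\<Sum>l\<le>n. coeff (char_poly A) l * markov n A B (l + m) i \<sigma> r))"
      unfolding sum_distrib_left
      by (subst sum.swap, rule sum.cong[OF refl], subst sum.swap) (simp add: algebra_simps)
    also have "\<dots> = 0" by (simp add: markov_cayley_hamilton[OF A])
    finally have "(\<Sum>l\<le>n. coeff (char_poly A) l * ?s (l + m)) = 0" .
    moreover have "(\<Sum>l<n. coeff (char_poly A) l * ?s (l + m)) = 0"
      using less False by (intro sum.neutral) (auto simp: m_def)
    ultimately show ?thesis
      using False degree_monic_char_poly[OF A]
      by (simp add: lessThan_Suc_atMost[symmetric] m_def)
  qed (rule z)
qed

text \<open>
  The Popov-Belevitch-Hautus argument, carried out inside the complement of the synchronization
  space: the families with zero sum that are orthogonal to all Markov parameters form a space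
  invariant under \<open>A\<^sup>*\<close>, and an eigenvector in it is a hidden mode.
\<close>

lemma disconnected_ctrb_imp_hidden_mode:
  assumes A: "A \<in> carrier_mat n n" and rel: "relative_actuation q n p B"
    and ncon: "\<not> connected_mat q n (ctrb_matrix q n p A B)"
  shows "\<exists>\<mu> z. hidden_mode q n p A B \<mu> z"
proof -
  let ?W = "ctrb_matrix q n p A B"
  obtain v where v: "v \<in> sync_perp q n" and nz: "\<exists>a<q * n. v $ a \<noteq> 0"
    and orth: "\<And>j. j < n * p \<Longrightarrow> (\<Sum>a<q * n. v $ a * ?W $$ (a, j)) = 0"
    using ncon unfolding connected_mat_iff_orthogonal[OF ctrb_matrix_class_G[OF A rel]]
    by (auto simp: ctrb_matrix_def)
  have orth_markov: "(\<Sum>i<q. \<Sum>r<n. v $ (i * n + r) * markov n A B k i \<sigma> r) = 0" if "\<sigma> < p" for k \<sigma>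
  proof (rule markov_annihilator_extends[OF A])
    fix k assume k: "k < n"
    have "(\<Sum>i<q. \<Sum>r<n. v $ (i * n + r) * markov n A B k i \<sigma> r)
        = (\<Sum>a<q * n. v $ a * ?W $$ (a, k * p + \<sigma>))"
      unfolding sum_blocks using k that by (intro sum.cong) (auto simp: ctrb_matrix_index[OF A])
    then show "(\<Sum>i<q. \<Sum>r<n. v $ (i * n + r) * markov n A B k i \<sigma> r) = 0"
      using orth[OF block_index_less[OF k that]] by simp
  qed
  define T :: "(nat \<times> nat \<Rightarrow> complex) \<Rightarrow> nat \<times> nat \<Rightarrow> complex"
    where "T = (\<lambda>Z (i, r). \<Sum>s<n. of_real (A $$ (s, r)) * Z (i, s))"
  define I :: "(nat \<times> nat \<Rightarrow> complex) \<Rightarrow> bool" where "I Z \<longleftrightarrow>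
      (\<forall>r<n. (\<Sum>i<q. Z (i, r)) = 0) \<and>
      (\<forall>k. \<forall>\<sigma><p. (\<Sum>i<q. \<Sum>r<n. cnj (Z (i, r)) * of_real (markov n A B k i \<sigma> r)) = 0)" for Z
  define Z :: "nat \<times> nat \<Rightarrow> complex" where "Z = (\<lambda>(i, r). of_real (v $ (i * n + r)))"
  have lin: "T (\<lambda>x. f x - c * g x) = (\<lambda>x. T f x - c * T g x)" for f g c
    by (auto simp: T_def fun_eq_iff algebra_simps sum_subtractf sum_distrib_left)
  have inv: "I (\<lambda>x. T f x - c * f x)" if If: "I f" for f c
  proof -
    have "(\<Sum>i<q. T f (i, r)) = (\<Sum>s<n. of_real (A $$ (s, r)) * (\<Sum>i<q. f (i, s)))" for r
      unfolding T_def by (simp add: sum_distrib_left) (rule sum.swap)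
    then have sum: "(\<Sum>i<q. T f (i, r)) = 0" for r
      using If by (simp add: I_def)
    \<comment> \<open>\<open>A\<^sup>*\<close> acting on the modes shifts the Markov parameters.\<close>
    have "(\<Sum>r<n. cnj (T f (i, r)) * of_real (markov n A B k i \<sigma> r))
        = (\<Sum>s<n. cnj (f (i, s)) * of_real (markov n A B (Suc k) i \<sigma> s))" for i k \<sigma>
      unfolding T_def by (simp add: markov_Suc[OF A] sum_distrib_left sum_distrib_right)
        (subst sum.swap, simp add: algebra_simps)
    then have "(\<Sum>i<q. \<Sum>r<n. cnj (T f (i, r)) * of_real (markov n A B k i \<sigma> r)) = 0"
      if "\<sigma> < p" for k \<sigma>
      using If that by (simp add: I_def)
    then show ?thesis using sum If
      by (simp add: I_def algebra_simps sum_subtractf flip: sum_distrib_left)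
  qed
  have iter: "(T ^^ k) Z (i, r) = (\<Sum>s<n. of_real ((A ^\<^sub>m k) $$ (s, r)) * Z (i, s))"
    if "r < n" for k i r
    using that
  proof (induction k arbitrary: r)
    case 0
    have "(\<Sum>s<n. of_real ((A ^\<^sub>m 0) $$ (s, r)) * Z (i, s)) = (\<Sum>s<n. if s = r then Z (i, s) else 0)"
      using A 0 by (intro sum.cong) auto
    then show ?case using 0 by simp
  next
    case (Suc k)
    have pow: "A ^\<^sub>m k \<in> carrier_mat n n" using A by simp
    have "(T ^^ Suc k) Z (i, r)
        = (\<Sum>t<n. of_real (A $$ (t, r)) * (\<Sum>s<n. of_real ((A ^\<^sub>m k) $$ (s, t)) * Z (i, s)))"
      using Suc.IH by (simp add: T_def)
    also have "\<dots> = (\<Sum>s<n. of_real (\<Sum>t<n. (A ^\<^sub>m k) $$ (s, t) * A $$ (t, r)) * Z (i, s))"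
      by (simp add: sum_distrib_left sum_distrib_right) (subst sum.swap, simp add: algebra_simps)
    finally show ?case
      using mult_mat_index_sum[OF pow A _ Suc.prems] by simp
  qed
  let ?X = "{..<q} \<times> {..<n}"
  let ?f = "map_poly of_real (char_poly A) :: complex poly"
  have deg: "degree ?f = n" using degree_monic_char_poly[OF A] by (simp add: degree_map_poly)
  have "\<exists>\<mu> Y. I Y \<and> (\<exists>x\<in>?X. Y x \<noteq> 0) \<and> (\<forall>x\<in>?X. T Y x = \<mu> * Y x)"
  proof (rule invariant_eigenvector_exists[where T = T and I = I and f = ?f and Z = Z, OF lin inv])
    show "?f \<noteq> 0"
      using degree_monic_char_poly[OF A] by (auto simp: map_poly_eq_0_iff)
    show "I Z"
      using v orth_markov by (auto simp: I_def Z_def sync_perp_iff simp flip: of_real_mult of_real_sum)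
    show "\<exists>x\<in>?X. Z x \<noteq> 0"
      using nz by (auto simp: Z_def elim!: block_index_cases)
    show "(\<Sum>k\<le>degree ?f. coeff ?f k * (T ^^ k) Z x) = 0" if "x \<in> ?X" for x
    proof -
      obtain i r where x: "x = (i, r)" "r < n" using \<open>x \<in> ?X\<close> by auto
      have "(\<Sum>k\<le>n. coeff ?f k * (T ^^ k) Z x)
          = (\<Sum>s<n. of_real (\<Sum>k\<le>n. coeff (char_poly A) k * (A ^\<^sub>m k) $$ (s, r)) * Z (i, s))"
        by (simp add: x iter coeff_map_poly sum_distrib_left sum_distrib_right)
          (subst sum.swap, simp add: algebra_simps)
      then show ?thesis unfolding deg using x by (simp add: cayley_hamilton_entry[OF A])
    qed
  qed
  then obtain \<mu> Y where IY: "I Y" and Ynz: "\<exists>x\<in>?X. Y x \<noteq> 0"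
    and TY: "\<forall>x\<in>?X. T Y x = \<mu> * Y x" by blast
  have "(\<Sum>i<q. \<Sum>r<n. cnj (Y (i, r)) * of_real (B i \<sigma> $$ (r, 0))) = 0" if "\<sigma> < p" for \<sigma>
  proof -
    have "(\<Sum>i<q. \<Sum>r<n. cnj (Y (i, r)) * of_real (markov n A B 0 i \<sigma> r)) = 0"
      using IY that unfolding I_def by blast
    then show ?thesis by (simp add: markov_0[OF A])
  qed
  then have "hidden_mode q n p A B \<mu> (\<lambda>i r. Y (i, r))"
    using IY Ynz TY by (auto simp: hidden_mode_def I_def T_def)
  then show ?thesis by blast
qed

section \<open>Hidden modes as obstructions to controllability\<close>

text \<open>
  An integrable function that equals its own indefinite integral up to constants is continuous,
  hence differentiable, so the integral equation upgrades itself to \<open>y' = c y\<close> and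
  \<open>exp (- c t) y t\<close> is constant.
\<close>

lemma scalar_integral_equation_solution:
  fixes y :: "real \<Rightarrow> complex"
  assumes \<tau>: "0 \<le> \<tau>"
    and eq: "\<And>t. t \<in> {0..\<tau>} \<Longrightarrow> ((\<lambda>s. c * y s) has_integral (y t - y0)) {0..t}"
  shows "y \<tau> = exp (\<tau> *\<^sub>R c) * y0"
proof -
  let ?S = "{0..\<tau>}"
  have yt: "y t = y0 + integral {0..t} (\<lambda>s. c * y s)" if "t \<in> ?S" for t
    using integral_unique[OF eq[OF that]] by simp
  have "(\<lambda>s. c * y s) integrable_on ?S" using eq[of \<tau>] \<tau> by (auto simp: integrable_on_def)
  then have "continuous_on ?S (\<lambda>t. y0 + integral {0..t} (\<lambda>s. c * y s))"
    by (intro continuous_intros indefinite_integral_continuous_1)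
  then have "continuous_on ?S y" by (rule continuous_on_eq) (rule yt[symmetric])
  then have cont: "continuous_on ?S (\<lambda>s. c * y s)" by (intro continuous_intros)
  have "(y has_vector_derivative c * y t) (at t within ?S)" if t: "t \<in> ?S" for t
  proof (rule has_vector_derivative_transform[OF t yt])
    show "((\<lambda>t. y0 + integral {0..t} (\<lambda>s. c * y s)) has_vector_derivative c * y t) (at t within ?S)"
      using has_vector_derivative_add[OF has_vector_derivative_const integral_has_vector_derivative[OF cont t]]
      by simp
  qed
  then have "((\<lambda>t. exp (t *\<^sub>R (- c)) * y t) has_vector_derivative 0) (at t within ?S)" if "t \<in> ?S" for t
    using has_vector_derivative_mult[OF exp_scaleR_has_vector_derivative_right[of "- c" t ?S]] that
    by (fastforce simp: algebra_simps)
  then obtain k where k: "\<And>t. t \<in> ?S \<Longrightarrow> exp (t *\<^sub>R (- c)) * y t = k"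
    using has_vector_derivative_zero_constant[of ?S "\<lambda>t. exp (t *\<^sub>R (- c)) * y t"] by (metis convex_real_interval(5))
  have "y 0 = y0" using yt[of 0] \<tau> by simp
  then have "exp (\<tau> *\<^sub>R (- c)) * y \<tau> = y0" using k[of 0] k[of \<tau>] \<tau> by simp
  then have "exp (\<tau> *\<^sub>R c) * y0 = (exp (\<tau> *\<^sub>R c) * exp (\<tau> *\<^sub>R (- c))) * y \<tau>" by simp
  also have "\<dots> = y \<tau>" by (simp add: exp_minus field_simps)
  finally show ?thesis ..
qed

text \<open>
  Along a solution the inputs cancel from \<open>y = \<Sum> z\<^sub>i\<^sup>* x\<^sub>i\<close>,
  leaving \<open>y' = cnj \<mu> y\<close>. Synchronization would force \<open>y = 0\<close> at
  the final time because the \<open>z\<^sub>i\<close> sum to zero, but an exponential does not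
  vanish.
\<close>

lemma hidden_mode_imp_not_controllable:
  assumes A: "A \<in> carrier_mat n n" and hid: "hidden_mode q n p A B \<mu> z"
  shows "\<not> array_controllable q n p A B"
proof
  assume con: "array_controllable q n p A B"
  have eig: "(\<Sum>s<n. of_real (A $$ (s, r)) * z i s) = \<mu> * z i r" if "i < q" "r < n" for i r
    using hid that by (simp add: hidden_mode_def)
  have zsum: "(\<Sum>i<q. z i r) = 0" if "r < n" for r
    using hid that by (simp add: hidden_mode_def)
  have zB: "(\<Sum>i<q. \<Sum>r<n. cnj (z i r) * of_real (B i \<sigma> $$ (r, 0))) = 0" if "\<sigma> < p" for \<sigma>
    using hid that by (simp add: hidden_mode_def)
  obtain i0 r0 where nz: "i0 < q" "r0 < n" "z i0 r0 \<noteq> 0"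
    using hid by (auto simp: hidden_mode_def)
  \<comment> \<open>Initial states are real, so start from the real part of the mode or,
    if \<open>y\<close> vanishes there, from its imaginary part: if \<open>y\<close> vanished at both, the mode
    would be zero.\<close>
  obtain w :: "nat \<Rightarrow> nat \<Rightarrow> real"
    where w: "(\<Sum>i<q. \<Sum>r<n. cnj (z i r) * of_real (w i r)) \<noteq> 0"
  proof (cases "(\<Sum>i<q. \<Sum>r<n. cnj (z i r) * of_real (Re (z i r))) = 0")
    case True
    have "(\<Sum>i<q. \<Sum>r<n. cnj (z i r) * of_real (Im (z i r))) \<noteq> 0"
    proof
      assume "(\<Sum>i<q. \<Sum>r<n. cnj (z i r) * of_real (Im (z i r))) = 0"
      then have im: "(\<Sum>i<q. \<Sum>r<n. (Im (z i r))\<^sup>2) = 0"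
        by (auto dest!: arg_cong[of _ _ Im] simp: power2_eq_square sum_negf)
      have re: "(\<Sum>i<q. \<Sum>r<n. (Re (z i r))\<^sup>2) = 0"
        using True by (auto dest!: arg_cong[of _ _ Re] simp: power2_eq_square)
      have "Im (z i0 r0) = 0"
        using im nz by (simp add: sum_nonneg_eq_0_iff sum_nonneg)
      moreover have "Re (z i0 r0) = 0"
        using re nz by (simp add: sum_nonneg_eq_0_iff sum_nonneg)
      ultimately show False using nz by (simp add: complex_eq_iff)
    qed
    then show ?thesis by (rule that)
  qed (rule that)
  define x0 where "x0 i = vec n (w i)" for i
  have "\<forall>i<q. x0 i \<in> carrier_vec n" by (simp add: x0_def)
  from con[unfolded array_controllable_def, THEN spec, THEN mp, OF this]
  obtain \<tau> u x where \<tau>: "\<tau> > 0"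
    and sol: "\<forall>i<q. array_solution n p A (B i) \<tau> u (x0 i) (x i)"
    and sync: "\<forall>i<q. \<forall>j<q. x i \<tau> = x j \<tau>"
    by (elim exE conjE) (rule that)
  define F where "F i r s = (A *\<^sub>v x i s) $ r + (\<Sum>\<sigma><p. B i \<sigma> $$ (r, 0) * u \<sigma> s)" for i r s
  have x_carrier: "x i t \<in> carrier_vec n" if "i < q" "t \<in> {0..\<tau>}" for i t
    using sol that by (simp add: array_solution_def)
  have F_int: "((\<lambda>s. F i r s) has_integral (x i t $ r - w i r)) {0..t}"
    if "i < q" "r < n" "t \<in> {0..\<tau>}" for i r t
  proof -
    have int: "set_integrable lebesgue {0..\<tau>} (F i r)"
      and eq: "x i t $ r = x0 i $ r + set_lebesgue_integral lebesgue {0..t} (F i r)"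
      using sol that by (auto simp: array_solution_def Let_def F_def[abs_def])
    have "set_integrable lebesgue {0..t} (F i r)"
      using that(3) by (intro set_integrable_subset[OF int]) auto
    from has_integral_set_lebesgue[OF this] show ?thesis using eq that by (simp add: x0_def)
  qed
  define y where "y t = (\<Sum>i<q. \<Sum>r<n. cnj (z i r) * of_real (x i t $ r))" for t
  define y0 where "y0 = (\<Sum>i<q. \<Sum>r<n. cnj (z i r) * of_real (w i r))"
  have rhs: "(\<Sum>i<q. \<Sum>r<n. cnj (z i r) * of_real (F i r s)) = cnj \<mu> * y s" if s: "s \<in> {0..\<tau>}" for s
  proof -
    have Ax: "(\<Sum>r<n. cnj (z i r) * of_real ((A *\<^sub>v x i s) $ r))
        = cnj \<mu> * (\<Sum>r<n. cnj (z i r) * of_real (x i s $ r))" if i: "i < q" for i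
    proof -
      have "(\<Sum>r<n. cnj (z i r) * of_real ((A *\<^sub>v x i s) $ r))
          = (\<Sum>r<n. \<Sum>t<n. cnj (z i r) * of_real (A $$ (r, t) * x i s $ t))"
        by (intro sum.cong)
          (simp_all add: mult_mat_vec_index_sum[OF A x_carrier[OF i s]] sum_distrib_left del: index_mult_mat_vec)
      also have "\<dots> = (\<Sum>t<n. cnj (\<Sum>r<n. of_real (A $$ (r, t)) * z i r) * of_real (x i s $ t))"
        by (subst sum.swap) (simp add: sum_distrib_left sum_distrib_right algebra_simps)
      also have "\<dots> = cnj \<mu> * (\<Sum>r<n. cnj (z i r) * of_real (x i s $ r))"
        using eig[OF i] by (simp add: sum_distrib_left algebra_simps)
      finally show ?thesis .
    qed
    have Bu: "(\<Sum>i<q. \<Sum>r<n. cnj (z i r) * of_real (\<Sum>\<sigma><p. B i \<sigma> $$ (r, 0) * u \<sigma> s)) = 0"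
    proof -
      have "(\<Sum>i<q. \<Sum>r<n. cnj (z i r) * of_real (\<Sum>\<sigma><p. B i \<sigma> $$ (r, 0) * u \<sigma> s))
          = (\<Sum>i<q. \<Sum>\<sigma><p. (\<Sum>r<n. cnj (z i r) * of_real (B i \<sigma> $$ (r, 0))) * of_real (u \<sigma> s))"
        by (rule sum.cong[OF refl])
          (simp add: sum_distrib_left sum_distrib_right, subst sum.swap, simp add: algebra_simps)
      also have "\<dots> = (\<Sum>\<sigma><p. (\<Sum>i<q. \<Sum>r<n. cnj (z i r) * of_real (B i \<sigma> $$ (r, 0))) * of_real (u \<sigma> s))"
        by (subst sum.swap) (simp add: sum_distrib_right)
      finally show ?thesis using zB by simp
    qed
    have "(\<Sum>i<q. \<Sum>r<n. cnj (z i r) * of_real (F i r s))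
        = (\<Sum>i<q. \<Sum>r<n. cnj (z i r) * of_real ((A *\<^sub>v x i s) $ r))
        + (\<Sum>i<q. \<Sum>r<n. cnj (z i r) * of_real (\<Sum>\<sigma><p. B i \<sigma> $$ (r, 0) * u \<sigma> s))"
      unfolding F_def by (simp only: of_real_add distrib_left sum.distrib)
    then show ?thesis using Ax Bu by (simp add: y_def sum_distrib_left)
  qed
  have "((\<lambda>s. cnj \<mu> * y s) has_integral (y t - y0)) {0..t}" if t: "t \<in> {0..\<tau>}" for t
  proof (rule has_integral_eq)
    have "((\<lambda>s. cnj (z i r) * of_real (F i r s)) has_integral
        (cnj (z i r) * of_real (x i t $ r - w i r))) {0..t}" if "i < q" "r < n" for i r
      using has_integral_linear[OF F_int[OF that t] bounded_linear_compose[OF bounded_linear_mult_right bounded_linear_of_real, of "cnj (z i r)"]]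
      by (simp add: o_def)
    then have "((\<lambda>s. \<Sum>i<q. \<Sum>r<n. cnj (z i r) * of_real (F i r s)) has_integral
        (\<Sum>i<q. \<Sum>r<n. cnj (z i r) * of_real (x i t $ r - w i r))) {0..t}"
      by (intro has_integral_sum) auto
    then show "((\<lambda>s. \<Sum>i<q. \<Sum>r<n. cnj (z i r) * of_real (F i r s)) has_integral (y t - y0)) {0..t}"
      by (simp add: y_def y0_def algebra_simps sum_subtractf)
    show "(\<Sum>i<q. \<Sum>r<n. cnj (z i r) * of_real (F i r s)) = cnj \<mu> * y s" if "s \<in> {0..t}" for s
      using that t by (intro rhs) auto
  qed
  then have "y \<tau> = exp (\<tau> *\<^sub>R cnj \<mu>) * y0" by (rule scalar_integral_equation_solution[OF less_imp_le[OF \<tau>]])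
  then have "y \<tau> \<noteq> 0" using w by (simp add: y0_def)
  moreover have "y \<tau> = (\<Sum>r<n. cnj (\<Sum>i<q. z i r) * of_real (x i0 \<tau> $ r))"
  proof -
    have "x i \<tau> = x i0 \<tau>" if "i < q" for i using sync nz(1) that by blast
    then have "y \<tau> = (\<Sum>i<q. \<Sum>r<n. cnj (z i r) * of_real (x i0 \<tau> $ r))" by (simp add: y_def)
    then show ?thesis by (subst (asm) sum.swap) (simp add: sum_distrib_right)
  qed
  then have "y \<tau> = 0" using zsum by simp
  ultimately show False by simp
qed

section \<open>Steering by polynomial inputs\<close>

text \<open>
  The solution is \<open>exp (t M) x0\<close>, written out as one power series per component so
  that the dimension may be an arbitrary number rather than a type.
\<close>

lemma linear_ode_solution_exists:
  fixes M :: "nat \<Rightarrow> nat \<Rightarrow> real" and x0 :: "nat \<Rightarrow> real"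
  shows "\<exists>h. \<forall>k<n. h k 0 = x0 k \<and>
    (\<forall>t. (h k has_real_derivative (\<Sum>l<n. M k l * h l t)) (at t))"
proof -
  \<comment> \<open>\<open>w j\<close> is \<open>M\<^sup>j x0\<close>.\<close>
  define w where "w = rec_nat x0 (\<lambda>_ v k. \<Sum>l<n. M k l * v l)"
  have w0: "w 0 = x0" and wS: "w (Suc j) k = (\<Sum>l<n. M k l * w j l)" for j k
    by (simp_all add: w_def)
  define K where "K = (\<Sum>k<n. \<Sum>l<n. \<bar>M k l\<bar>)"
  define C where "C = (\<Sum>k<n. \<bar>x0 k\<bar>)"
  have K: "(\<Sum>l<n. \<bar>M k l\<bar>) \<le> K" if "k < n" for k
    unfolding K_def using that by (intro member_le_sum[of k]) (auto intro: sum_nonneg)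
  have "K \<ge> 0" "C \<ge> 0" by (auto simp: K_def C_def intro!: sum_nonneg)
  have bound: "\<bar>w j k\<bar> \<le> C * K ^ j" if "k < n" for j k
    using that
  proof (induction j arbitrary: k)
    case 0
    then show ?case unfolding w0 C_def by (auto intro: member_le_sum[of k])
  next
    case (Suc j)
    have "\<bar>w (Suc j) k\<bar> \<le> (\<Sum>l<n. \<bar>M k l\<bar> * (C * K ^ j))"
      unfolding wS using Suc.IH
      by (intro order_trans[OF sum_abs] sum_mono) (auto simp: abs_mult intro: mult_left_mono)
    also have "\<dots> \<le> K * (C * K ^ j)"
      unfolding sum_distrib_right[symmetric]
      using K[OF Suc.prems] \<open>K \<ge> 0\<close> \<open>C \<ge> 0\<close> by (intro mult_right_mono) auto
    finally show ?case by (simp add: algebra_simps)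
  qed
  define c where "c k j = w j k / fact j" for k j
  have summ: "summable (\<lambda>j. c k j * t ^ j)" if k: "k < n" for k t
  proof (rule summable_comparison_test')
    show "summable (\<lambda>j. C * (inverse (fact j) * (K * \<bar>t\<bar>) ^ j))"
      by (intro summable_mult summable_exp)
    fix j
    have "\<bar>w j k\<bar> * (\<bar>t\<bar> ^ j / fact j) \<le> (C * K ^ j) * (\<bar>t\<bar> ^ j / fact j)"
      by (intro mult_right_mono bound k) auto
    then show "norm (c k j * t ^ j) \<le> C * (inverse (fact j) * (K * \<bar>t\<bar>) ^ j)"
      by (simp add: c_def abs_mult power_abs power_mult_distrib field_simps)
  qed
  define h where "h k t = (\<Sum>j. c k j * t ^ j)" for k t
  have "h k 0 = x0 k \<and> (\<forall>t. (h k has_real_derivative (\<Sum>l<n. M k l * h l t)) (at t))"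
    if k: "k < n" for k
  proof (intro conjI allI)
    show "h k 0 = x0 k" unfolding h_def powser_zero by (simp add: c_def w0)
    fix t
    have "diffs (c k) j * t ^ j = (\<Sum>l<n. M k l * (c l j * t ^ j))" for j
    proof -
      have "diffs (c k) j = w (Suc j) k / fact j"
        by (simp add: diffs_def c_def field_simps del: of_nat_Suc)
      then show ?thesis
        by (simp add: wS c_def sum_divide_distrib sum_distrib_left sum_distrib_right algebra_simps)
    qed
    then have "(\<Sum>j. diffs (c k) j * t ^ j) = (\<Sum>j. \<Sum>l<n. M k l * (c l j * t ^ j))" by simp
    also have "\<dots> = (\<Sum>l<n. \<Sum>j. M k l * (c l j * t ^ j))"
      by (rule suminf_sum) (auto intro: summable_mult summ)
    also have "\<dots> = (\<Sum>l<n. M k l * h l t)"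
      unfolding h_def by (intro sum.cong refl suminf_mult summ) auto
    finally show "(h k has_real_derivative (\<Sum>l<n. M k l * h l t)) (at t)"
      unfolding h_def[abs_def]
      using termdiffs_strong_converges_everywhere[of "c k" t, OF summ[OF k]] by simp
  qed
  then show ?thesis by blast
qed

text \<open>
  The states \<open>r i\<close> can be reached from rest at time 1 along polynomial trajectories
  \<open>P\<close> with polynomial inputs \<open>U\<close>. The differential equation is an
  identity between polynomials, so no analysis is involved.
\<close>

definition poly_reachable ::
  "nat \<Rightarrow> nat \<Rightarrow> nat \<Rightarrow> real mat \<Rightarrow> (nat \<Rightarrow> nat \<Rightarrow> real mat) \<Rightarrow> (nat \<Rightarrow> nat \<Rightarrow> real) \<Rightarrow> bool"
  where "poly_reachable q n p A B r \<longleftrightarrow> (\<exists>U P. \<forall>i<q. \<forall>k<n.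
    pderiv (P i k) = (\<Sum>l<n. Polynomial.smult (A $$ (k, l)) (P i l))
      + (\<Sum>\<sigma><p. Polynomial.smult (B i \<sigma> $$ (k, 0)) (U \<sigma>)) \<and>
    poly (P i k) 0 = 0 \<and> poly (P i k) 1 = r i k)"

lemma poly_reachable_cong:
  assumes "poly_reachable q n p A B r" "\<And>i k. i < q \<Longrightarrow> k < n \<Longrightarrow> r i k = r' i k"
  shows "poly_reachable q n p A B r'"
proof -
  from assms(1) obtain U P where "\<forall>i<q. \<forall>k<n.
    pderiv (P i k) = (\<Sum>l<n. Polynomial.smult (A $$ (k, l)) (P i l))
      + (\<Sum>\<sigma><p. Polynomial.smult (B i \<sigma> $$ (k, 0)) (U \<sigma>)) \<and>
    poly (P i k) 0 = 0 \<and> poly (P i k) 1 = r i k"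
    unfolding poly_reachable_def by (elim exE) (rule that)
  then show ?thesis
    unfolding poly_reachable_def by (intro exI[of _ U] exI[of _ P]) (simp add: assms(2))
qed

lemma poly_reachable_lincomb:
  assumes "poly_reachable q n p A B r" "poly_reachable q n p A B r'"
  shows "poly_reachable q n p A B (\<lambda>i k. c * r i k + c' * r' i k)"
proof -
  obtain U P U' P' where
    "\<forall>i<q. \<forall>k<n. pderiv (P i k) = (\<Sum>l<n. Polynomial.smult (A $$ (k, l)) (P i l))
      + (\<Sum>\<sigma><p. Polynomial.smult (B i \<sigma> $$ (k, 0)) (U \<sigma>)) \<and>
      poly (P i k) 0 = 0 \<and> poly (P i k) 1 = r i k"
    "\<forall>i<q. \<forall>k<n. pderiv (P' i k) = (\<Sum>l<n. Polynomial.smult (A $$ (k, l)) (P' i l))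
      + (\<Sum>\<sigma><p. Polynomial.smult (B i \<sigma> $$ (k, 0)) (U' \<sigma>)) \<and>
      poly (P' i k) 0 = 0 \<and> poly (P' i k) 1 = r' i k"
    using assms unfolding poly_reachable_def by (elim exE) (rule that)
  then show ?thesis unfolding poly_reachable_def
    by (intro exI[of _ "\<lambda>\<sigma>. Polynomial.smult c (U \<sigma>) + Polynomial.smult c' (U' \<sigma>)"]
        exI[of _ "\<lambda>i k. Polynomial.smult c (P i k) + Polynomial.smult c' (P' i k)"])
      (simp add: pderiv_add pderiv_smult smult_add_right sum.distrib smult_sum2 mult.commute)
qed

lemma poly_reachable_zero: "poly_reachable q n p A B (\<lambda>i k. 0)"
  unfolding poly_reachable_def by (intro exI[of _ "\<lambda>_. 0"] exI[of _ "\<lambda>_ _. 0"]) simp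

lemma poly_reachable_sum:
  assumes "finite S" "\<And>a. a \<in> S \<Longrightarrow> poly_reachable q n p A B (r a)"
  shows "poly_reachable q n p A B (\<lambda>i k. \<Sum>a\<in>S. c a * r a i k)"
  using assms
proof (induction S)
  case (insert a S)
  then have "poly_reachable q n p A B (\<lambda>i k. c a * r a i k + 1 * (\<Sum>a\<in>S. c a * r a i k))"
    by (intro poly_reachable_lincomb) auto
  then show ?case using insert.hyps by simp
qed (simp add: poly_reachable_zero)

text \<open>
  Horner's scheme for the characteristic polynomial \<open>\<chi>\<close> with coefficients
  \<open>a\<close>, evaluated at the differentiation operator and applied to
  \<open>\<psi>\<close>: the element \<open>n\<close> is \<open>\<chi>(D) \<psi>\<close>, and
  the elements below \<open>n\<close> are the coefficients of the powers of \<open>A\<close> in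
  \<open>((\<chi>(D) - \<chi>(A)) / (D - A)) \<psi>\<close>.
\<close>

primrec flat_chain :: "(nat \<Rightarrow> real) \<Rightarrow> nat \<Rightarrow> real poly \<Rightarrow> nat \<Rightarrow> real poly" where
  "flat_chain a n \<psi> 0 = \<psi>"
| "flat_chain a n \<psi> (Suc m) = pderiv (flat_chain a n \<psi> m) + Polynomial.smult (a (n - Suc m)) \<psi>"

text \<open>
  Each step of the chain differentiates once, so a zero of order \<open>N\<close> of
  \<open>\<psi>\<close> becomes a zero of order exactly \<open>N - m\<close>; the added multiple
  of \<open>\<psi>\<close> still vanishes to higher order and cannot interfere.
\<close>

lemma flat_chain_order:
  assumes \<psi>: "\<psi> = [:- c, 1:] ^ N * r" and r: "poly r c \<noteq> 0" and m: "m \<le> N"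
  shows "\<exists>r'. flat_chain a n \<psi> m = [:- c, 1:] ^ (N - m) * r' \<and> poly r' c \<noteq> 0"
  using m
proof (induction m)
  case 0
  then show ?case using \<psi> r by auto
next
  case (Suc m)
  define X where "X = [:- c, 1:]"
  define j where "j = N - Suc m"
  have N: "N - m = Suc j" "N = j + Suc m" using Suc.prems by (auto simp: j_def)
  obtain r' where r': "flat_chain a n \<psi> m = X ^ Suc j * r'" "poly r' c \<noteq> 0"
    using Suc N by (auto simp: X_def)
  let ?r = "X * pderiv r' + Polynomial.smult (of_nat (Suc j)) r'
    + Polynomial.smult (a (n - Suc m)) (X ^ Suc m * r)"
  have dX: "pderiv X = 1" by (simp add: X_def pderiv_pCons)
  have "flat_chain a n \<psi> (Suc m) = X ^ j * ?r"
    unfolding flat_chain.simps r'(1) pderiv_mult pderiv_power_Suc dX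
    by (simp add: \<psi> X_def[symmetric] N(2) power_add algebra_simps smult_add_right)
  moreover have "poly ?r c \<noteq> 0" using r'(2) by (simp add: X_def)
  ultimately show ?case by (auto simp: X_def j_def)
qed

text \<open>
  Applying \<open>D - A\<close> to the sum telescopes: \<open>A\<close> shifts the Markov
  parameter up by one and \<open>D\<close> shifts the chain up by one. What remains is the last
  chain element times \<open>B\<close> and the multiple \<open>\<chi>(A) B\<close> of
  \<open>\<psi>\<close>, which Cayley-Hamilton removes.
\<close>

lemma flat_chain_trajectory:
  fixes A :: "real mat" and \<psi> :: "real poly" and B :: "nat \<Rightarrow> nat \<Rightarrow> real mat" and i \<sigma> :: nat
  assumes A: "A \<in> carrier_mat n n" and k: "k < n"
  defines "\<chi> \<equiv> flat_chain (coeff (char_poly A)) n \<psi>"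
  defines "P \<equiv> \<lambda>k. \<Sum>m<n. Polynomial.smult (markov n A B (n - Suc m) i \<sigma> k) (\<chi> m)"
  shows "pderiv (P k) = (\<Sum>l<n. Polynomial.smult (A $$ (k, l)) (P l))
    + Polynomial.smult (B i \<sigma> $$ (k, 0)) (\<chi> n)"
proof -
  let ?a = "coeff (char_poly A)"
  define \<beta> where "\<beta> j = markov n A B j i \<sigma> k" for j
  define g where "g m = Polynomial.smult (\<beta> (n - m)) (\<chi> m)" for m
  have \<chi>_Suc: "pderiv (\<chi> m) = \<chi> (Suc m) - Polynomial.smult (?a (n - Suc m)) \<psi>" for m
    by (simp add: \<chi>_def)
  have AP: "(\<Sum>l<n. Polynomial.smult (A $$ (k, l)) (P l)) = (\<Sum>m<n. g m)"
  proof -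
    have "(\<Sum>l<n. Polynomial.smult (A $$ (k, l)) (P l))
        = (\<Sum>m<n. Polynomial.smult (\<Sum>l<n. A $$ (k, l) * markov n A B (n - Suc m) i \<sigma> l) (\<chi> m))"
      unfolding P_def smult_sum2 smult_sum by (subst sum.swap) simp
    also have "\<dots> = (\<Sum>m<n. g m)"
      by (intro sum.cong refl) (simp add: markov_Suc[OF A k, symmetric] Suc_diff_Suc g_def \<beta>_def)
    finally show ?thesis .
  qed
  have "pderiv (P k) = (\<Sum>m<n. g (Suc m)) - (\<Sum>m<n. Polynomial.smult (?a (n - Suc m) * \<beta> (n - Suc m)) \<psi>)"
    by (simp add: P_def pderiv_sum pderiv_smult \<chi>_Suc smult_diff_right sum_subtractf g_def \<beta>_def mult.commute)
  also have "(\<Sum>m<n. g (Suc m)) = (\<Sum>m<n. g m) + g n - g 0"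
    using sum.lessThan_Suc_shift[of g n] by simp
  also have "(\<Sum>m<n. Polynomial.smult (?a (n - Suc m) * \<beta> (n - Suc m)) \<psi>)
      = Polynomial.smult (\<Sum>l<n. ?a l * \<beta> l) \<psi>"
    unfolding smult_sum[symmetric]
    using sum.nat_diff_reindex[of "\<lambda>l. ?a l * \<beta> l" n] by simp
  also have "(\<Sum>l<n. ?a l * \<beta> l) = - \<beta> n"
    using markov_cayley_hamilton[OF A k, where m = 0 and B = B and i = i and \<sigma> = \<sigma>] degree_monic_char_poly[OF A]
    by (simp add: \<beta>_def lessThan_Suc_atMost[symmetric] add_eq_0_iff)
  finally show ?thesis
    unfolding AP by (simp add: g_def \<chi>_def \<beta>_def markov_0[OF A k])
qed

text \<open>
  Choose \<open>\<psi> = x\<^sup>n (x - 1)\<^sup>e\<close> with \<open>e = n - 1 - j\<close>.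
  The zero at 0 makes the trajectory start at rest. The zero at 1 kills the coefficients of all
  Markov parameters above \<open>j\<close> in the end point and leaves a nonzero coefficient at
  \<open>j\<close>, so the end points are triangular in the Markov parameters and these are
  reached one after the other.
\<close>

lemma markov_poly_reachable:
  assumes A: "A \<in> carrier_mat n n" and \<sigma>: "\<sigma> < p" and j: "j < n"
  shows "poly_reachable q n p A B (\<lambda>i k. markov n A B j i \<sigma> k)"
  using j
proof (induction j rule: less_induct)
  case (less j)
  define e where "e = n - Suc j"
  define \<psi> :: "real poly" where "\<psi> = [:- 0, 1:] ^ n * [:- 1, 1:] ^ e"
  define \<chi> where "\<chi> = flat_chain (coeff (char_poly A)) n \<psi>"
  define P where "P i k = (\<Sum>m<n. Polynomial.smult (markov n A B (n - Suc m) i \<sigma> k) (\<chi> m))" for i k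
  have at0: "poly (\<chi> m) 0 = 0" if "m < n" for m
    using flat_chain_order[where \<psi> = \<psi> and c = 0 and N = n and r = "[:- 1, 1:] ^ e" and m = m
        and n = n and a = "coeff (char_poly A)"] that
    by (auto simp: \<psi>_def \<chi>_def)
  have at1: "poly (\<chi> m) 1 = 0 \<longleftrightarrow> m < e" if "m \<le> e" for m
    using flat_chain_order[where \<psi> = \<psi> and c = 1 and N = e and r = "[:- 0, 1:] ^ n" and m = m
        and n = n and a = "coeff (char_poly A)"] that
    by (auto simp: \<psi>_def \<chi>_def)
  have reach: "poly_reachable q n p A B (\<lambda>i k. poly (P i k) 1)"
    unfolding poly_reachable_def
  proof (intro exI[of _ "\<lambda>\<sigma>'. if \<sigma>' = \<sigma> then \<chi> n else 0"] exI[of _ P] allI impI conjI)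
    fix i k assume k: "k < n"
    show "pderiv (P i k) = (\<Sum>l<n. Polynomial.smult (A $$ (k, l)) (P i l))
      + (\<Sum>\<sigma>'<p. Polynomial.smult (B i \<sigma>' $$ (k, 0)) (if \<sigma>' = \<sigma> then \<chi> n else 0))"
      using flat_chain_trajectory[OF A k, of B i \<sigma> \<psi>] \<sigma>
      by (simp add: P_def \<chi>_def if_distrib cong: if_cong)
    show "poly (P i k) 0 = 0" by (simp add: P_def poly_sum at0)
  qed simp
  have P1: "poly (P i k) 1 = poly (\<chi> e) 1 * markov n A B j i \<sigma> k
      + (\<Sum>l<j. poly (\<chi> (n - Suc l)) 1 * markov n A B l i \<sigma> k)" for i k
  proof -
    let ?f = "\<lambda>l. poly (\<chi> (n - Suc l)) 1 * markov n A B l i \<sigma> k"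
    have "poly (P i k) 1 = (\<Sum>m<n. ?f (n - Suc m))"
      by (simp add: P_def poly_sum mult.commute Suc_diff_Suc)
    also have "\<dots> = (\<Sum>l<n. ?f l)" by (rule sum.nat_diff_reindex)
    also have "\<dots> = (\<Sum>l<Suc j. ?f l)"
      using less.prems at1 by (intro sum.mono_neutral_right) (auto simp: e_def)
    finally show ?thesis by (simp add: e_def)
  qed
  have "poly_reachable q n p A B (\<lambda>i k. \<Sum>l<j. poly (\<chi> (n - Suc l)) 1 * markov n A B l i \<sigma> k)"
    using less by (intro poly_reachable_sum) auto
  then have "poly_reachable q n p A B (\<lambda>i k. inverse (poly (\<chi> e) 1) * poly (P i k) 1
      + (- inverse (poly (\<chi> e) 1)) * (\<Sum>l<j. poly (\<chi> (n - Suc l)) 1 * markov n A B l i \<sigma> k))"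
    by (intro poly_reachable_lincomb reach)
  then show ?case
    using at1[of e] by (rule_tac poly_reachable_cong) (auto simp: P1 field_simps)
qed

text \<open>
  By linearity, a free motion may be added to a controlled trajectory starting at rest. The
  latter is steered to the difference between the mean of the free end points and each free end
  point; then all states end at the mean.
\<close>

lemma connected_ctrb_imp_controllable:
  assumes A: "A \<in> carrier_mat n n" and q: "q > 0"
    and con: "connected_mat q n (ctrb_matrix q n p A B)"
  shows "array_controllable q n p A B"
  unfolding array_controllable_def
proof (intro allI impI)
  fix x0 :: "nat \<Rightarrow> real vec"
  let ?W = "ctrb_matrix q n p A B"
  have "\<forall>i. \<exists>h. \<forall>k<n. h k 0 = x0 i $ k \<and>
      (\<forall>t. (h k has_real_derivative (\<Sum>l<n. A $$ (k, l) * h l t)) (at t))"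
    using linear_ode_solution_exists[of n _ "\<lambda>k l. A $$ (k, l)"] by blast
  then obtain h where h: "\<forall>i. \<forall>k<n. h i k 0 = x0 i $ k \<and>
      (\<forall>t. (h i k has_real_derivative (\<Sum>l<n. A $$ (k, l) * h i l t)) (at t))"
    by (rule choice[THEN exE])
  define avg where "avg k = (\<Sum>i<q. h i k 1) / q" for k
  define v where "v = vec (q * n) (\<lambda>a. avg (a mod n) - h (a div n) (a mod n) 1)"
  have v_index: "v $ (i * n + k) = avg k - h i k 1" if "i < q" "k < n" for i k
    using that block_index_less[OF that] by (simp add: v_def)
  have "v \<in> sync_perp q n"
    using q by (simp add: sync_perp_iff v_index sum_subtractf avg_def) (simp add: v_def)
  then obtain y where y: "y \<in> carrier_vec (n * p)" and vy: "v = ?W *\<^sub>v y"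
    using con by (auto simp: connected_mat_def mat_range_def ctrb_matrix_def)
  have W: "?W \<in> carrier_mat (q * n) (n * p)" by (simp add: ctrb_matrix_def)
  have "poly_reachable q n p A B (\<lambda>i k. \<Sum>a\<in>{..<n} \<times> {..<p}. y $ (fst a * p + snd a)
      * markov n A B (fst a) i (snd a) k)"
    by (intro poly_reachable_sum) (auto intro!: markov_poly_reachable[OF A])
  then have "poly_reachable q n p A B (\<lambda>i k. avg k - h i k 1)"
  proof (rule poly_reachable_cong)
    fix i k assume ik: "i < q" "k < n"
    have "avg k - h i k 1 = (\<Sum>c<n * p. ?W $$ (i * n + k, c) * y $ c)"
      using mult_mat_vec_index_sum[OF W y block_index_less[OF ik]] v_index[OF ik] by (simp add: vy)
    also have "\<dots> = (\<Sum>j<n. \<Sum>\<sigma><p. y $ (j * p + \<sigma>) * markov n A B j i \<sigma> k)"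
      unfolding sum_blocks using ik by (intro sum.cong) (auto simp: ctrb_matrix_index[OF A])
    also have "\<dots> = (\<Sum>a\<in>{..<n} \<times> {..<p}. y $ (fst a * p + snd a) * markov n A B (fst a) i (snd a) k)"
      by (simp add: sum.cartesian_product case_prod_beta)
    finally show "(\<Sum>a\<in>{..<n} \<times> {..<p}. y $ (fst a * p + snd a) * markov n A B (fst a) i (snd a) k)
      = avg k - h i k 1" ..
  qed
  then obtain U P where UP: "\<forall>i<q. \<forall>k<n.
    pderiv (P i k) = (\<Sum>l<n. Polynomial.smult (A $$ (k, l)) (P i l))
      + (\<Sum>\<sigma><p. Polynomial.smult (B i \<sigma> $$ (k, 0)) (U \<sigma>)) \<and>
    poly (P i k) 0 = 0 \<and> poly (P i k) 1 = avg k - h i k 1"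
    unfolding poly_reachable_def by (elim exE) (rule that)
  define x where "x i t = vec n (\<lambda>k. h i k t + poly (P i k) t)" for i t
  define u where "u \<sigma> = poly (U \<sigma>)" for \<sigma>
  have u_int: "set_integrable lebesgue {0..1} (u \<sigma>)" for \<sigma>
    unfolding u_def by (intro absolutely_integrable_continuous_real continuous_intros)
  have sol: "array_solution n p A (B i) 1 u (x0 i) (x i)" if i: "i < q" for i
    unfolding array_solution_def Let_def
  proof (intro conjI ballI allI impI)
    fix k assume k: "k < n"
    define f where "f s = (A *\<^sub>v x i s) $ k + (\<Sum>\<sigma><p. B i \<sigma> $$ (k, 0) * u \<sigma> s)" for s
    have f_eq: "f s = (\<Sum>l<n. A $$ (k, l) * h i l s) + poly (pderiv (P i k)) s" for s
    proof -
      have xs: "x i s \<in> carrier_vec n" by (simp add: x_def)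
      show ?thesis
        unfolding f_def mult_mat_vec_index_sum[OF A xs k] using UP i k
        by (simp add: x_def u_def poly_sum distrib_left sum.distrib)
    qed
    have deriv: "((\<lambda>t. h i k t + poly (P i k) t) has_real_derivative f s) (at s)" for s
      unfolding f_eq using h k by (intro DERIV_add poly_DERIV) auto
    have "continuous_on S (h i l)" if "l < n" for S l
      using h that by (intro DERIV_continuous_on[of S "h i l" "\<lambda>t. \<Sum>m<n. A $$ (l, m) * h i m t"])
        (auto intro: DERIV_subset)
    then have "continuous_on {0..1} f" unfolding f_eq[abs_def] by (intro continuous_intros) auto
    then have f_int: "set_integrable lebesgue {0..1} f"
      by (rule absolutely_integrable_continuous_real)
    then show "set_integrable lebesgue {0..1} (\<lambda>s. (A *\<^sub>v x i s) $ k + (\<Sum>\<sigma><p. B i \<sigma> $$ (k, 0) * u \<sigma> s))"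
      by (simp add: f_def[abs_def])
    fix t :: real assume t: "t \<in> {0..1}"
    have "(f has_integral ((h i k t + poly (P i k) t) - (h i k 0 + poly (P i k) 0))) {0..t}"
      using t deriv by (intro fundamental_theorem_of_calculus)
        (auto simp flip: has_real_derivative_iff_has_vector_derivative intro: DERIV_subset)
    then have I: "integral {0..t} f = h i k t + poly (P i k) t - x0 i $ k"
      using h UP i k by (simp add: integral_unique)
    have "set_integrable lebesgue {0..t} f"
      using t by (intro set_integrable_subset[OF f_int]) auto
    then have "set_lebesgue_integral lebesgue {0..t} f = h i k t + poly (P i k) t - x0 i $ k"
      using I by (simp add: set_lebesgue_integral_eq_integral)
    then show "x i t $ k = x0 i $ k + set_lebesgue_integral lebesgue {0..t}
        (\<lambda>s. (A *\<^sub>v x i s) $ k + (\<Sum>\<sigma><p. B i \<sigma> $$ (k, 0) * u \<sigma> s))"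
      using k by (simp add: f_def[abs_def] x_def)
  qed (simp add: x_def)
  have "x i 1 = vec n avg" if "i < q" for i
    using UP that by (intro eq_vecI) (auto simp: x_def)
  then show "\<exists>\<tau>>0. \<exists>u x. (\<forall>\<sigma><p. set_integrable lebesgue {0..\<tau>} (u \<sigma>)) \<and>
      (\<forall>i<q. array_solution n p A (B i) \<tau> u (x0 i) (x i)) \<and> (\<forall>i<q. \<forall>j<q. x i \<tau> = x j \<tau>)"
    using u_int sol by (intro exI[of _ 1] conjI exI[of _ u] exI[of _ x]) auto
qed

section \<open>Hidden modes and the eigenvector matrices\<close>

lemma adjoint_eigenspace_iff:
  fixes A :: "real mat"
  assumes A: "A \<in> carrier_mat n n" and v: "v \<in> carrier_vec n"
  shows "v \<in> mat_kernel (mat_adjoint (cmat A) - \<mu> \<cdot>\<^sub>m 1\<^sub>m n) \<longleftrightarrow>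
    (\<forall>r<n. (\<Sum>s<n. of_real (A $$ (s, r)) * v $ s) = \<mu> * v $ r)"
proof -
  let ?M = "mat_adjoint (cmat A) - \<mu> \<cdot>\<^sub>m 1\<^sub>m n"
  have cA: "cmat A \<in> carrier_mat n n" using A by simp
  have M: "?M \<in> carrier_mat n n" by auto
  have "(?M *\<^sub>v v) $ r = (\<Sum>s<n. of_real (A $$ (s, r)) * v $ s) - \<mu> * v $ r" if r: "r < n" for r
  proof -
    have "(?M *\<^sub>v v) $ r = (\<Sum>s<n. ?M $$ (r, s) * v $ s)"
      by (rule mult_mat_vec_index_sum[OF M v r])
    also have "\<dots> = (\<Sum>s<n. of_real (A $$ (s, r)) * v $ s - (if s = r then \<mu> * v $ s else 0))"
      using A r mat_adjoint_carrier[OF cA]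
      by (intro sum.cong) (auto simp: mat_adjoint_index[OF cA] algebra_simps)
    finally show ?thesis using r by (simp add: sum_subtractf)
  qed
  moreover have "?M *\<^sub>v v = 0\<^sub>v n \<longleftrightarrow> (\<forall>r<n. (?M *\<^sub>v v) $ r = 0)"
    using mult_mat_vec_carrier[OF M v] by (auto simp del: index_mult_mat_vec intro!: eq_vecI)
  ultimately show ?thesis using v by (simp add: mat_kernel[OF M])
qed

lemma hidden_mode_eigenvalue:
  assumes A: "A \<in> carrier_mat n n" and hid: "hidden_mode q n p A B \<mu> z"
  shows "\<mu> \<in> spectrum (mat_adjoint (cmat A))"
proof -
  let ?A = "mat_adjoint (cmat A)"
  have cA: "cmat A \<in> carrier_mat n n" using A by simp
  note A' = mat_adjoint_carrier[OF cA]
  obtain i r where ir: "i < q" "r < n" "z i r \<noteq> 0" using hid by (auto simp: hidden_mode_def)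
  let ?v = "vec n (z i)"
  have "?A *\<^sub>v ?v = \<mu> \<cdot>\<^sub>v ?v"
  proof (rule eq_vecI)
    fix s assume "s < dim_vec (\<mu> \<cdot>\<^sub>v ?v)"
    then have s: "s < n" by simp
    have "(?A *\<^sub>v ?v) $ s = (\<Sum>t<n. of_real (A $$ (t, s)) * z i t)"
      using mult_mat_vec_index_sum[OF A' _ s, of ?v] A s by (simp add: mat_adjoint_index[OF cA])
    then show "(?A *\<^sub>v ?v) $ s = (\<mu> \<cdot>\<^sub>v ?v) $ s"
      using hid ir s by (simp add: hidden_mode_def)
  qed (use A' in auto)
  moreover have "?v \<noteq> 0\<^sub>v n" using ir by (metis index_vec index_zero_vec(1))
  ultimately have "eigenvector ?A ?v \<mu>" using A' by (auto simp: eigenvector_def)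
  then show ?thesis by (auto simp: spectrum_def eigenvalue_def)
qed

text \<open>
  Stacked coordinate vectors \<open>w\<close> correspond to families of eigenvectors by
  \<open>z\<^sub>i = V w\<^sub>i\<close>. Under this correspondence, block sums go to sums
  because \<open>V\<close> is injective, and orthogonality to the columns of \<open>inc
  (V\<^sup>* B)\<close> is the vanishing of \<open>\<Sum> z\<^sub>i\<^sup>*
  B\<^sub>i\<^sub>\<sigma>\<close>.
\<close>

lemma connected_inc_iff_no_hidden_mode:
  assumes A: "A \<in> carrier_mat n n"
    and B: "\<And>i \<sigma>. i < q \<Longrightarrow> \<sigma> < p \<Longrightarrow> B i \<sigma> \<in> carrier_mat n 1"
    and rel: "relative_actuation q n p B"
    and V: "V \<in> carrier_mat n d" and rank: "vec_space.rank n V = d"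
    and range: "mat_range V = mat_kernel (mat_adjoint (cmat A) - \<mu> \<cdot>\<^sub>m 1\<^sub>m n)"
  shows "connected_mat q d (inc q p d 1 (\<lambda>i \<sigma>. mat_adjoint V * cmat (B i \<sigma>))) \<longleftrightarrow>
    \<not> (\<exists>z. hidden_mode q n p A B \<mu> z)"
proof -
  define G where "G = inc q p d 1 (\<lambda>i \<sigma>. mat_adjoint V * cmat (B i \<sigma>))"
  have dim: "dim_row G = q * d" "dim_col G = p" by (simp_all add: G_def inc_def)
  have G_index: "G $$ (i * d + k, \<sigma>) = (\<Sum>r<n. cnj (V $$ (r, k)) * of_real (B i \<sigma> $$ (r, 0)))"
    if "i < q" "k < d" "\<sigma> < p" for i k \<sigma>
  proof -
    have cB: "cmat (B i \<sigma>) \<in> carrier_mat n 1" using B that by simp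
    have "G $$ (i * d + k, \<sigma>) = (mat_adjoint V * cmat (B i \<sigma>)) $$ (k, 0)"
      using that block_index_less[OF that(1,2)] by (simp add: G_def inc_def)
    also have "\<dots> = (\<Sum>r<n. mat_adjoint V $$ (k, r) * cmat (B i \<sigma>) $$ (r, 0))"
      using that by (intro mult_mat_index_sum[OF mat_adjoint_carrier[OF V] cB]) auto
    also have "\<dots> = (\<Sum>r<n. cnj (V $$ (r, k)) * of_real (B i \<sigma> $$ (r, 0)))"
      using that B[OF that(1,3)] by (intro sum.cong) (auto simp: mat_adjoint_index[OF V])
    finally show ?thesis .
  qed
  have class_G: "G \<in> class_G q d"
  proof (rule class_GI)
    fix \<sigma> k assume "\<sigma> < dim_col G" and k: "k < d"
    then have \<sigma>: "\<sigma> < p" by (simp add: dim)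
    have "(\<Sum>i<q. G $$ (i * d + k, \<sigma>))
        = (\<Sum>r<n. cnj (V $$ (r, k)) * of_real (\<Sum>i<q. B i \<sigma> $$ (r, 0)))"
      using G_index[OF _ k \<sigma>] by (simp add: sum_distrib_left) (rule sum.swap)
    then show "(\<Sum>i<q. G $$ (i * d + k, \<sigma>)) = 0" using rel \<sigma> by (simp add: relative_actuation_def flip: of_real_sum)
  qed (rule dim)
  define blk :: "complex vec \<Rightarrow> nat \<Rightarrow> complex vec" where "blk w i = vec d (\<lambda>k. w $ (i * d + k))" for w i
  have V_blk: "(V *\<^sub>v blk w i) $ r = (\<Sum>k<d. V $$ (r, k) * w $ (i * d + k))" if "r < n" for w i r
    using mult_mat_vec_index_sum[OF V _ that, of "blk w i"] by (simp add: blk_def)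
  have pairing: "(\<Sum>i<q. \<Sum>r<n. cnj ((V *\<^sub>v blk w i) $ r) * of_real (B i \<sigma> $$ (r, 0)))
      = cnj (\<Sum>a<q * d. w $ a * conjugate (G $$ (a, \<sigma>)))" if \<sigma>: "\<sigma> < p" for w \<sigma>
  proof -
    have "(\<Sum>r<n. cnj ((V *\<^sub>v blk w i) $ r) * of_real (B i \<sigma> $$ (r, 0)))
        = (\<Sum>k<d. cnj (w $ (i * d + k)) * G $$ (i * d + k, \<sigma>))" if i: "i < q" for i
    proof -
      have "(\<Sum>r<n. cnj ((V *\<^sub>v blk w i) $ r) * of_real (B i \<sigma> $$ (r, 0)))
          = (\<Sum>r<n. \<Sum>k<d. cnj (w $ (i * d + k)) * (cnj (V $$ (r, k)) * of_real (B i \<sigma> $$ (r, 0))))"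
        by (intro sum.cong refl) (simp add: V_blk sum_distrib_left sum_distrib_right algebra_simps del: index_mult_mat_vec)
      also have "\<dots> = (\<Sum>k<d. cnj (w $ (i * d + k)) * G $$ (i * d + k, \<sigma>))"
        by (subst sum.swap) (simp add: G_index[OF i _ \<sigma>] sum_distrib_left)
      finally show ?thesis .
    qed
    then show ?thesis unfolding sum_blocks by simp
  qed
  have sum_V: "(\<Sum>i<q. (V *\<^sub>v blk w i) $ r) = (\<Sum>k<d. V $$ (r, k) * (\<Sum>i<q. w $ (i * d + k)))"
    if "r < n" for w r
    by (simp add: V_blk[OF that] sum_distrib_left del: index_mult_mat_vec) (rule sum.swap)
  have inj: "x = 0\<^sub>v d" if "x \<in> carrier_vec d" "V *\<^sub>v x = 0\<^sub>v n" for x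
    by (rule full_column_rank_injective[OF V rank that])
  have "(\<exists>z. hidden_mode q n p A B \<mu> z) \<longleftrightarrow>
    (\<exists>w\<in>sync_perp q d. (\<forall>\<sigma><p. (\<Sum>a<q * d. w $ a * conjugate (G $$ (a, \<sigma>))) = 0) \<and>
      (\<exists>a<q * d. w $ a \<noteq> 0))" (is "_ \<longleftrightarrow> ?R")
  proof
    assume ?R
    then obtain w a where w: "w \<in> sync_perp q d" and a: "a < q * d" "w $ a \<noteq> 0"
      and orth: "\<And>\<sigma>. \<sigma> < p \<Longrightarrow> (\<Sum>a<q * d. w $ a * conjugate (G $$ (a, \<sigma>))) = 0"
      by blast
    obtain i k where ik: "i < q" "k < d" "a = i * d + k" using a(1) by (rule block_index_cases)
    have "blk w i $ k \<noteq> 0" using a ik by (simp add: blk_def)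
    then have "blk w i \<noteq> 0\<^sub>v d" using ik by auto
    then have "V *\<^sub>v blk w i \<noteq> 0\<^sub>v n" using inj[of "blk w i"] by (auto simp: blk_def)
    then have nz: "\<exists>r<n. (V *\<^sub>v blk w i) $ r \<noteq> 0"
      using V by (auto simp del: index_mult_mat_vec intro!: eq_vecI)
    have "V *\<^sub>v blk w i \<in> mat_range V" for i
      using V by (auto simp: mat_range_def blk_def)
    then have "\<forall>r<n. (\<Sum>s<n. of_real (A $$ (s, r)) * (V *\<^sub>v blk w i) $ s) = \<mu> * (V *\<^sub>v blk w i) $ r" for i
      using adjoint_eigenspace_iff[OF A, of "V *\<^sub>v blk w i" \<mu>] V
      by (simp add: range blk_def del: index_mult_mat_vec)
    moreover have "(\<Sum>i<q. (V *\<^sub>v blk w i) $ r) = 0" if "r < n" for r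
      using w by (simp add: sum_V[OF that] sync_perp_iff del: index_mult_mat_vec)
    moreover have "(\<Sum>i<q. \<Sum>r<n. cnj ((V *\<^sub>v blk w i) $ r) * of_real (B i \<sigma> $$ (r, 0))) = 0"
      if "\<sigma> < p" for \<sigma>
      unfolding pairing[OF that] orth[OF that] by simp
    ultimately have "hidden_mode q n p A B \<mu> (\<lambda>i r. (V *\<^sub>v blk w i) $ r)"
      unfolding hidden_mode_def using nz ik(1) by (auto simp del: index_mult_mat_vec)
    then show "\<exists>z. hidden_mode q n p A B \<mu> z" by blast
  next
    assume "\<exists>z. hidden_mode q n p A B \<mu> z"
    then obtain z where z: "hidden_mode q n p A B \<mu> z" by blast
    have "\<exists>x. x \<in> carrier_vec d \<and> V *\<^sub>v x = vec n (z i)" if i: "i < q" for i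
    proof -
      have "\<forall>r<n. (\<Sum>s<n. of_real (A $$ (s, r)) * vec n (z i) $ s) = \<mu> * vec n (z i) $ r"
        using z i by (simp add: hidden_mode_def)
      then have "vec n (z i) \<in> mat_range V"
        using adjoint_eigenspace_iff[OF A, of "vec n (z i)" \<mu>] by (simp add: range)
      then show ?thesis using V by (auto simp: mat_range_def)
    qed
    then obtain x where x: "\<And>i. i < q \<Longrightarrow> x i \<in> carrier_vec d"
      and Vx: "\<And>i. i < q \<Longrightarrow> V *\<^sub>v x i = vec n (z i)" by metis
    define w where "w = vec (q * d) (\<lambda>a. x (a div d) $ (a mod d))"
    have blk: "blk w i = x i" if "i < q" for i
      using x[OF that] that block_index_less[OF that] by (intro eq_vecI) (auto simp: blk_def w_def)
    have zV: "z i r = (V *\<^sub>v blk w i) $ r" if "i < q" "r < n" for i r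
      using Vx[OF that(1)] that by (simp add: blk del: index_mult_mat_vec)
    have "vec d (\<lambda>k. \<Sum>i<q. w $ (i * d + k)) = 0\<^sub>v d" (is "?s = _")
    proof (rule inj)
      have "(V *\<^sub>v ?s) $ r = 0" if r: "r < n" for r
      proof -
        have "(V *\<^sub>v ?s) $ r = (\<Sum>k<d. V $$ (r, k) * (\<Sum>i<q. w $ (i * d + k)))"
          using mult_mat_vec_index_sum[OF V _ r, of ?s] by simp
        also have "\<dots> = (\<Sum>i<q. z i r)" using zV r by (simp add: sum_V[symmetric] del: index_mult_mat_vec)
        finally show ?thesis using z r by (simp add: hidden_mode_def)
      qed
      then show "V *\<^sub>v ?s = 0\<^sub>v n" using V by (intro eq_vecI) (auto simp del: index_mult_mat_vec)
    qed simp
    then have "(\<Sum>i<q. w $ (i * d + k)) = 0" if "k < d" for k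
      using that by (metis index_vec index_zero_vec(1))
    then have "w \<in> sync_perp q d" by (simp add: sync_perp_iff) (simp add: w_def)
    moreover have "(\<Sum>a<q * d. w $ a * conjugate (G $$ (a, \<sigma>))) = 0" if \<sigma>: "\<sigma> < p" for \<sigma>
    proof -
      have "cnj (\<Sum>a<q * d. w $ a * conjugate (G $$ (a, \<sigma>)))
          = (\<Sum>i<q. \<Sum>r<n. cnj (z i r) * of_real (B i \<sigma> $$ (r, 0)))"
        unfolding pairing[OF \<sigma>, symmetric] by (intro sum.cong refl) (simp add: zV del: index_mult_mat_vec)
      also have "\<dots> = 0" using z \<sigma> by (simp add: hidden_mode_def)
      finally show ?thesis by (simp only: complex_cnj_zero_iff)
    qed
    moreover have "\<exists>a<q * d. w $ a \<noteq> 0"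
    proof (rule ccontr)
      assume "\<not> (\<exists>a<q * d. w $ a \<noteq> 0)"
      then have "z i r = 0" if "i < q" "r < n" for i r
        using that block_index_less[OF that(1), of _ d]
        by (simp add: zV V_blk del: index_mult_mat_vec)
      then show False using z by (auto simp: hidden_mode_def)
    qed
    ultimately show ?R by blast
  qed
  then show ?thesis
    unfolding G_def[symmetric] connected_mat_iff_orthogonal[OF class_G] dim by blast
qed

section \<open>The equivalence\<close>

theorem theorem1:
  fixes q n p m :: nat
    and A :: "real mat"
    and B :: "nat \<Rightarrow> nat \<Rightarrow> real mat"
    and \<mu> :: "nat \<Rightarrow> complex"
    and d :: "nat \<Rightarrow> nat"
    and V :: "nat \<Rightarrow> complex mat"
  assumes "q \<ge> 2" and "n \<ge> 1" and "p \<ge> 1"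
    and "A \<in> carrier_mat n n"
    and "\<And>i \<sigma>. i < q \<Longrightarrow> \<sigma> < p \<Longrightarrow> B i \<sigma> \<in> carrier_mat n 1"
    and "relative_actuation q n p B"
    and "inj_on \<mu> {..<m}"
    and "\<mu> ` {..<m} = spectrum (mat_adjoint (cmat A))"
    and "\<And>\<kappa>. \<kappa> < m \<Longrightarrow> V \<kappa> \<in> carrier_mat n (d \<kappa>)"
    and "\<And>\<kappa>. \<kappa> < m \<Longrightarrow> vec_space.rank n (V \<kappa>) = d \<kappa>"
    and "\<And>\<kappa>. \<kappa> < m \<Longrightarrow>
           mat_range (V \<kappa>) = mat_kernel (mat_adjoint (cmat A) - \<mu> \<kappa> \<cdot>\<^sub>m 1\<^sub>m n)"
    and "\<And>\<kappa>. \<kappa> < m \<Longrightarrow> \<mu> \<kappa> \<in> \<real> \<Longrightarrow> elements_mat (V \<kappa>) \<subseteq> \<real>"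
  shows "(array_controllable q n p A B \<longleftrightarrow> connected_mat q n (ctrb_matrix q n p A B)) \<and>
         (connected_mat q n (ctrb_matrix q n p A B) \<longleftrightarrow>
            (\<forall>\<kappa><m. connected_mat q (d \<kappa>)
               (inc q p (d \<kappa>) 1 (\<lambda>i \<sigma>. mat_adjoint (V \<kappa>) * cmat (B i \<sigma>)))))"
proof -
  note A = \<open>A \<in> carrier_mat n n\<close> and rel = \<open>relative_actuation q n p B\<close>
  have inc_iff: "connected_mat q (d \<kappa>) (inc q p (d \<kappa>) 1 (\<lambda>i \<sigma>. mat_adjoint (V \<kappa>) * cmat (B i \<sigma>)))
      \<longleftrightarrow> \<not> (\<exists>z. hidden_mode q n p A B (\<mu> \<kappa>) z)" if "\<kappa> < m" for \<kappa>
    by (rule connected_inc_iff_no_hidden_mode[OF A assms(5) rel assms(9-11)[OF that]])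
  \<comment> \<open>Only eigenvalues of \<open>A\<^sup>*\<close> carry hidden modes, and the \<open>\<mu> \<kappa>\<close> exhaust them.\<close>
  have mode_iff: "(\<exists>\<kappa><m. \<exists>z. hidden_mode q n p A B (\<mu> \<kappa>) z) \<longleftrightarrow> (\<exists>\<nu> z. hidden_mode q n p A B \<nu> z)"
  proof
    assume "\<exists>\<nu> z. hidden_mode q n p A B \<nu> z"
    then obtain \<nu> z where z: "hidden_mode q n p A B \<nu> z" by blast
    then have "\<nu> \<in> \<mu> ` {..<m}" using hidden_mode_eigenvalue[OF A] assms(8) by simp
    then show "\<exists>\<kappa><m. \<exists>z. hidden_mode q n p A B (\<mu> \<kappa>) z" using z by auto
  qed blast
  have "array_controllable q n p A B" if "connected_mat q n (ctrb_matrix q n p A B)"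
    using connected_ctrb_imp_controllable[OF A _ that] \<open>q \<ge> 2\<close> by simp
  moreover have "\<not> (\<exists>\<nu> z. hidden_mode q n p A B \<nu> z)" if "array_controllable q n p A B"
    using hidden_mode_imp_not_controllable[OF A] that by blast
  moreover have "connected_mat q n (ctrb_matrix q n p A B)" if "\<not> (\<exists>\<nu> z. hidden_mode q n p A B \<nu> z)"
    using disconnected_ctrb_imp_hidden_mode[OF A rel] that by blast
  ultimately show ?thesis using inc_iff mode_iff by blast
qed

end
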